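(* Assume that $\mathsf{Ax}$ holds. Then there exists a non $\sigma$-compact subgroup $G_M$ of the additive group $\mathbb{R}$, of cardinality $\mathfrak{d}$, such that: (1) $G_M$ satisfies $\mathsf{S}_{fin}(\Omega,\Omega)$. (2) Whenever for each $m\ge 1$, $U_m$ is an open subset of $G_M$ and $(g_{m,n})_{n\ge 1}$ is a sequence of elements of $G_M$ such that $\{g_{m,n}+U_m : n\ge 1\}$ is a cover of $G_M$, there exists a sequence $(m_n)_{n\ge 1}$ of natural numbers such that for each finite subset $F$ of $G_M$ there exists $n$ with $F\subseteq\{g_{n,1},\dots,g_{n,m_n}\}+U_n$. Moreover, the same statement holds with $G_M$ replaced by $(G_M)^k$, for every $k\ge 1$.
   Context: For $f,g\in{}^{\mathbb{N}}\mathbb{N}$, $f\le^* g$ means $f(n)\le g(n)$ for all but finitely many $n$. A subset of ${}^{\mathbb{N}}\mathbb{N}$ is dominating if it is cofinal in ${}^{\mathbb{N}}\mathbb{N}$ with respect to $\le^*$. $\mathfrak{b}$ (respectively $\mathfrak{d}$) is the minimal cardinality of a $\le^*$-unbounded (respectively dominating) subset of ${}^{\mathbb{N}}\mathbb{N}$. A set $Y\subseteq{}^{\mathbb{N}}\mathbb{N}$ is finitely-dominating if for each $g\in{}^{\mathbb{N}}\mathbb{N}$ there exist $k$ and $f_1,\dots,f_k\in Y$ such that $g(n)\le\max\{f_1(n),\dots,f_k(n)\}$ for all but finitely many $n$. $\mathsf{Ax}$ is the assertion: either every union of fewer than $\mathfrak{d}$ many non-dominating sets is not dominating (equivalently, $\mathfrak{b}=\mathfrak{d}$),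 or else every union of fewer than $\mathfrak{d}$ many sets of increasing functions, each not finitely-dominating, is not finitely-dominating. For a topological space $X$, an open cover $\mathcal{U}$ of $X$ is an $\omega$-cover if $X\notin\mathcal{U}$ and for each finite $F\subseteq X$ there is $U\in\mathcal{U}$ with $F\subseteq U$. $\Omega$ is the collection of all countable open $\omega$-covers of $X$. $X$ satisfies $\mathsf{S}_{fin}(\Omega,\Omega)$ if for each sequence $\{\mathcal{U}_n\}_{n\in\mathbb{N}}$ of members of $\Omega$ there exist finite (possibly empty) $\mathcal{F}_n\subseteq\mathcal{U}_n$ such that $\bigcup_n\mathcal{F}_n\in\Omega$. *)

theory Defs
  imports "HOL-Analysis.Analysis" "HOL-Algebra.Product_Groups"
begin

unbundle cardinal_syntax

definition le_star :: "(nat \<Rightarrow> nat) \<Rightarrow> (nat \<Rightarrow> nat) \<Rightarrow> bool" (infix \<open>\<le>*\<close> 50)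
  where "f \<le>* g \<longleftrightarrow> (\<forall>\<^sub>F n in sequentially. f n \<le> g n)"

definition dominating :: "(nat \<Rightarrow> nat) set \<Rightarrow> bool"
  where "dominating D \<longleftrightarrow> (\<forall>f. \<exists>g\<in>D. f \<le>* g)"

definition finitely_dominating :: "(nat \<Rightarrow> nat) set \<Rightarrow> bool"
  where "finitely_dominating Y \<longleftrightarrow>
    (\<forall>g. \<exists>F. finite F \<and> F \<noteq> {} \<and> F \<subseteq> Y \<and>
       (\<forall>\<^sub>F n in sequentially. g n \<le> Max ((\<lambda>f. f n) ` F)))"

(* The cardinal is the order relation |D| of a dominating set D of least cardinality;
   dominating_number_spec below shows that the choice is well defined. *)
definition dominating_number :: "(nat \<Rightarrow> nat) rel"
  where "dominating_number =
    card_of (SOME D. dominating D \<and> (\<forall>E. dominating E \<longrightarrow> |D| \<le>o |E| ))"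

lemma dominating_number_spec:
  "\<exists>D. dominating D \<and> dominating_number = |D|"
  "dominating E \<Longrightarrow> dominating_number \<le>o |E|"
proof -
  let ?R = "card_of ` Collect dominating"
  have "dominating UNIV"
    unfolding dominating_def le_star_def by (auto intro: always_eventually)
  then have "?R \<noteq> {}" by blast
  moreover have "\<forall>r\<in>?R. Card_order r" by (simp add: card_of_Card_order)
  ultimately have "\<exists>r\<in>?R. \<forall>r'\<in>?R. r \<le>o r'" by (rule exists_minim_Card_order)
  then have "\<exists>D. dominating D \<and> (\<forall>E. dominating E \<longrightarrow> |D| \<le>o |E| )" by blast
  from someI_ex[OF this]
  show "\<exists>D. dominating D \<and> dominating_number = |D|"
    "dominating E \<Longrightarrow> dominating_number \<le>o |E|"
    unfolding dominating_number_def by blast+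
qed

definition Ax :: bool
  where "Ax \<longleftrightarrow>
    (\<forall>\<F> :: (nat \<Rightarrow> nat) set set.
       |\<F>| <o dominating_number \<and> (\<forall>Y\<in>\<F>. \<not> dominating Y) \<longrightarrow> \<not> dominating (\<Union>\<F>)) \<or>
    (\<forall>\<F> :: (nat \<Rightarrow> nat) set set.
       |\<F>| <o dominating_number \<and>
       (\<forall>Y\<in>\<F>. (\<forall>f\<in>Y. strict_mono f) \<and> \<not> finitely_dominating Y) \<longrightarrow>
       \<not> finitely_dominating (\<Union>\<F>))"

definition omega_cover :: "'a topology \<Rightarrow> 'a set set \<Rightarrow> bool"
  where "omega_cover X \<U> \<longleftrightarrow>
    (\<forall>U\<in>\<U>. openin X U) \<and> \<Union>\<U> = topspace X \<and> topspace X \<notin> \<U> \<and>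
    (\<forall>F. finite F \<and> F \<subseteq> topspace X \<longrightarrow> (\<exists>U\<in>\<U>. F \<subseteq> U))"

definition Omega_covers :: "'a topology \<Rightarrow> 'a set set set"
  where "Omega_covers X = {\<U>. countable \<U> \<and> omega_cover X \<U>}"

definition S_fin :: "'b set set \<Rightarrow> 'b set set \<Rightarrow> bool"
  where "S_fin \<A> \<B> \<longleftrightarrow>
    (\<forall>u :: nat \<Rightarrow> 'b set. (\<forall>n. u n \<in> \<A>) \<longrightarrow>
       (\<exists>v. (\<forall>n. finite (v n) \<and> v n \<subseteq> u n) \<and> (\<Union>n. v n) \<in> \<B>))"

definition sigma_compact_space :: "'a topology \<Rightarrow> bool"
  where "sigma_compact_space X \<longleftrightarrow>
    (\<exists>\<K>. countable \<K> \<and> (\<forall>K\<in>\<K>. compactin X K) \<and> \<Union>\<K> = topspace X)"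

definition real_group :: "real monoid"
  where "real_group = \<lparr>carrier = UNIV, monoid.mult = (+), one = 0\<rparr>"

lemma group_real_group: "group real_group"
  unfolding real_group_def
proof (rule groupI; simp)
  show "\<exists>y. y + x = 0" for x :: real
    by (metis add.left_inverse)
qed

(* For a group G whose carrier is the underlying set of the space X.  Left cosets and
   set products are translates g + U and sums A + U when G is written additively. *)
definition translate_selection :: "('a, 'b) monoid_scheme \<Rightarrow> 'a topology \<Rightarrow> bool"
  where "translate_selection G X \<longleftrightarrow>
    (\<forall>(U :: nat \<Rightarrow> 'a set) (g :: nat \<Rightarrow> nat \<Rightarrow> 'a).
       (\<forall>m\<ge>1. openin X (U m) \<and> (\<forall>n\<ge>1. g m n \<in> carrier G) \<and>
               (\<Union>n\<in>{1..}. g m n <#\<^bsub>G\<^esub> U m) = carrier G) \<longrightarrow>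
       (\<exists>M :: nat \<Rightarrow> nat. \<forall>F. finite F \<and> F \<subseteq> carrier G \<longrightarrow>
          (\<exists>n\<ge>1. F \<subseteq> (g n ` {1..M n}) <#>\<^bsub>G\<^esub> U n)))"

end

theory Submission
  imports Defs
begin

text \<open>
  Code a set \<open>x\<close> of naturals by the real \<open>ternary x = (\<Sum>n\<in>x. 3 ^ -n)\<close>.  The group is the rational
  span of \<open>1\<close> and the codes of a family \<open>M\<close> of \<open>d\<close> infinite sets, where \<open>d\<close> is the dominating
  number.  The family is built by recursion so that for each \<open>h\<close>, all but fewer than \<open>d\<close> members have
  simultaneous gaps \<open>[n, h n)\<close>.  A finite tuple of sets without elements in \<open>[n, h n)\<close> agrees
  up to \<open>h n\<close> with one of finitely many tuples of subsets of \<open>[0, n)\<close>, so finitely many members of the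
  \<open>n\<close>-th cover contain all such tuples; tuples with an exceptional coordinate are handled by induction on
  their length and by the closure of an ideal of sets of functions under unions of fewer than \<open>d\<close>
  members.  This ideal consists of the bounded sets in the first case of \<open>Ax\<close>, and of the not finitely
  dominating sets in the second.  It yields the selection principle for all finite powers
  of the group at once.

  An uncountable \<open>\<sigma>\<close>-compact set of reals has the cardinality of the continuum, and there are only continuum
  many of them.  If \<open>M\<close> is linearly independent, its subsets generate more than \<open>d\<close> different groups,
  so one of them is not \<open>\<sigma>\<close>-compact.
\<close>

section \<open>Cardinals below the dominating number\<close>

text \<open>By induction on the length, the lists of each fixed length number at most
  \<open>|A|\<close>; the union over countably many lengths does not exceed an infinite
  cardinal.\<close>

lemma card_of_lists_le:
  assumes "infinite A"
  shows "|lists A| \<le>o |A|"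
proof -
  have len: "|{xs. set xs \<subseteq> A \<and> length xs = n}| \<le>o |A|" for n
  proof (induction n)
    case 0
    have "{xs. set xs \<subseteq> A \<and> length xs = 0} = {[]}" by auto
    moreover have "A \<noteq> {}" using assms by auto
    ultimately show ?case by (metis card_of_singl_ordLeq)
  next
    case (Suc n)
    have "{xs. set xs \<subseteq> A \<and> length xs = Suc n} =
        (\<lambda>(x, xs). x # xs) ` (A \<times> {xs. set xs \<subseteq> A \<and> length xs = n})"
      by (auto simp: length_Suc_conv image_iff)
    then have "|{xs. set xs \<subseteq> A \<and> length xs = Suc n}| \<le>o
        |A \<times> {xs. set xs \<subseteq> A \<and> length xs = n}|"
      by (simp only: card_of_image)
    also have "|A \<times> {xs. set xs \<subseteq> A \<and> length xs = n}| \<le>o |A|"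
      using card_of_Times_ordLeq_infinite_Field[of "|A|", OF _ _ Suc card_of_Card_order]
        assms ordIso_imp_ordLeq[OF card_of_refl[of A]] unfolding Field_card_of by blast
    finally show ?case .
  qed
  have "lists A = (\<Union>n. {xs. set xs \<subseteq> A \<and> length xs = n})" by auto
  moreover have "|UNIV :: nat set| \<le>o |A|" using assms infinite_iff_card_of_nat by blast
  ultimately show ?thesis
    using card_of_UNION_ordLeq_infinite[OF assms] len by (metis (no_types, lifting))
qed

definition small :: "'a set \<Rightarrow> bool"
  where "small A \<longleftrightarrow> |A| <o dominating_number"

lemma small_not_dominating: "small Y \<Longrightarrow> \<not> dominating Y"
  unfolding small_def by (auto dest: dominating_number_spec(2) not_ordLess_ordLeq)

text \<open>A diagonal argument. It makes d uncountable, which the arithmetic of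
  \<open>small\<close> rests on.\<close>

lemma countable_imp_not_dominating:
  assumes "countable Y"
  shows "\<not> dominating Y"
proof
  assume dom: "dominating Y"
  then have "Y \<noteq> {}" unfolding dominating_def by blast
  define e where "e = from_nat_into Y"
  have Y: "Y = range e" using assms \<open>Y \<noteq> {}\<close> by (simp add: e_def)
  \<comment> \<open>At \<open>n\<close> this exceeds the first \<open>n + 1\<close> functions of the
    enumeration. Hence at \<open>max i N\<close> it exceeds the \<open>i\<close>-th one, beyond the
    threshold \<open>N\<close> past which the opposite should hold.\<close>
  define g where "g n = Suc (Max ((\<lambda>i. e i n) ` {..n}))" for n
  obtain i where "g \<le>* e i" using dom Y unfolding dominating_def by blast
  then obtain N where N: "\<And>n. n \<ge> N \<Longrightarrow> g n \<le> e i n"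
    unfolding le_star_def eventually_sequentially by blast
  have "e i (max i N) \<le> Max ((\<lambda>j. e j (max i N)) ` {..max i N})" by (intro Max_ge) auto
  with N[of "max i N"] show False by (simp add: g_def)
qed

lemma dominating_number_eq_card_of:
  obtains D where "dominating D" "dominating_number = |D|" "uncountable D"
proof -
  obtain D where "dominating D" "dominating_number = |D|" using dominating_number_spec(1) by auto
  with countable_imp_not_dominating that show ?thesis by metis
qed

lemma small_ordLeq: "|A| \<le>o |B| \<Longrightarrow> small B \<Longrightarrow> small A"
  unfolding small_def by (rule ordLeq_ordLess_trans)

lemma small_mono: "A \<subseteq> B \<Longrightarrow> small B \<Longrightarrow> small A"
  by (rule small_ordLeq[OF card_of_mono1])

lemma small_image: "small A \<Longrightarrow> small (f ` A)"
  by (rule small_ordLeq[OF card_of_image])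

lemma countable_imp_small:
  assumes "countable A"
  shows "small A"
proof -
  obtain D where "dominating D" and D: "dominating_number = |D|" "uncountable D"
    by (rule dominating_number_eq_card_of)
  have "\<not> |D| \<le>o |A|"
  proof
    assume "|D| \<le>o |A|"
    then obtain f where "inj_on f D" "f ` D \<subseteq> A" using card_of_ordLeq by metis
    then show False using assms D(2) countable_image_inj_on countable_subset by metis
  qed
  then show ?thesis
    unfolding small_def D(1) by (simp add: not_ordLeq_iff_ordLess card_of_Well_order)
qed

lemma small_Un:
  assumes "small A" "small B"
  shows "small (A \<union> B)"
proof -
  obtain D where "dominating D" and D: "dominating_number = |D|" "uncountable D"
    by (rule dominating_number_eq_card_of)
  then have "infinite D" using countable_finite by auto
  then show ?thesis using assms card_of_Un_ordLess_infinite unfolding small_def D(1) by metis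
qed

lemma small_lists:
  assumes "small A"
  shows "small (lists A)"
proof (cases "finite A")
  case True
  then have "countable (lists A)" by (simp add: countable_finite)
  then show ?thesis by (rule countable_imp_small)
next
  case False
  then show ?thesis using assms card_of_lists_le small_ordLeq by metis
qed

text \<open>Pairs are coded as two-element lists over the disjoint sum, so the finite and the
  infinite case are both inherited from \<open>small_lists\<close>.\<close>

lemma small_Times:
  assumes "small A" "small B"
  shows "small (A \<times> B)"
proof -
  let ?p = "\<lambda>xs. (projl (hd xs), projr (hd (tl xs)))"
  have "A \<times> B \<subseteq> ?p ` lists (Inl ` A \<union> Inr ` B)"
  proof clarify
    fix a b assume "a \<in> A" "b \<in> B"
    then have "[Inl a, Inr b] \<in> lists (Inl ` A \<union> Inr ` B)" by auto
    then show "(a, b) \<in> ?p ` lists (Inl ` A \<union> Inr ` B)" by (rule rev_image_eqI) simp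
  qed
  moreover have "small (?p ` lists (Inl ` A \<union> Inr ` B))"
    using assms by (intro small_image small_lists small_Un)
  ultimately show ?thesis by (rule small_mono)
qed

lemma small_finite_subsets:
  assumes "small A"
  shows "small {T. finite T \<and> T \<subseteq> A}"
proof -
  have "{T. finite T \<and> T \<subseteq> A} \<subseteq> set ` lists A"
    using finite_list by (fastforce simp: image_iff)
  then show ?thesis using assms small_lists small_image small_mono by metis
qed

section \<open>Sets of naturals with long gaps\<close>

definition next_in :: "nat set \<Rightarrow> nat \<Rightarrow> nat"
  where "next_in A n = (LEAST m. m \<in> A \<and> n \<le> m)"

lemma next_in:
  assumes "infinite A"
  shows "next_in A n \<in> A" "n \<le> next_in A n"
proof -
  have "\<exists>m. m \<in> A \<and> n \<le> m" using assms by (meson infinite_nat_iff_unbounded_le)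
  from LeastI_ex[OF this] show "next_in A n \<in> A" "n \<le> next_in A n"
    unfolding next_in_def by auto
qed

text \<open>The sparseness for the second case of \<open>Ax\<close>. Two such sets may have their
  gaps at different places, so common gaps have to be arranged during the recursion.\<close>

definition often_gap :: "nat set \<Rightarrow> (nat \<Rightarrow> nat) \<Rightarrow> bool"
  where "often_gap x f \<longleftrightarrow> infinite {n. x \<inter> {n..<f n} = {}}"

text \<open>The sparseness for the first case of \<open>Ax\<close>. It concerns almost all elements,
  so finitely many thin sets have common gaps automatically (\<open>thin_avoids\<close>).\<close>

definition thin :: "nat set \<Rightarrow> (nat \<Rightarrow> nat) \<Rightarrow> bool"
  where "thin x f \<longleftrightarrow> (\<exists>N. \<forall>m\<in>x. \<forall>m'\<in>x. N \<le> m \<and> m < m' \<longrightarrow> f m \<le> m')"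

text \<open>A requirement that \<open>x\<close> itself violates, for \<open>often_gap\<close> as
  well as for \<open>thin\<close>: the inner \<open>Suc\<close> looks for an element strictly after
  \<open>n\<close>, the outer one places the end of the gap just beyond it.\<close>

definition jump :: "nat set \<Rightarrow> nat \<Rightarrow> nat"
  where "jump x n = Suc (next_in x (Suc n))"

lemma often_gap_jump: "infinite x \<Longrightarrow> \<not> often_gap x (jump x)"
proof -
  assume x: "infinite x"
  have "x \<inter> {n..<jump x n} \<noteq> {}" for n
    using next_in[OF x, of "Suc n"] unfolding jump_def
    by (metis IntI atLeastLessThan_iff empty_iff lessI Suc_leD)
  then show ?thesis by (simp add: often_gap_def)
qed

lemma thin_jump: "infinite x \<Longrightarrow> \<not> thin x (jump x)"
proof
  assume x: "infinite x" and "thin x (jump x)"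
  then obtain N where N: "\<And>m m'. m \<in> x \<Longrightarrow> m' \<in> x \<Longrightarrow> N \<le> m \<Longrightarrow> m < m' \<Longrightarrow> jump x m \<le> m'"
    unfolding thin_def by blast
  show False
    using N[of "next_in x N" "next_in x (Suc (next_in x N))"] next_in[OF x, of N]
      next_in[OF x, of "Suc (next_in x N)"] by (simp add: jump_def)
qed

definition runmax :: "(nat \<Rightarrow> nat) \<Rightarrow> nat \<Rightarrow> nat"
  where "runmax f n = Max (f ` {..n})"

lemma runmax_ge: "m \<le> n \<Longrightarrow> f m \<le> runmax f n"
  unfolding runmax_def by (rule Max_ge) auto

lemma mono_runmax: "mono (runmax f)"
  unfolding runmax_def by (intro monoI Max_mono) auto

text \<open>An orbit of 0. The summand \<open>n + 1\<close> makes it strictly increasing; the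
  running maximum makes each element bound \<open>f\<close> on everything up to the preceding
  element, for arbitrary \<open>f\<close>.\<close>

definition iterates :: "(nat \<Rightarrow> nat) \<Rightarrow> nat set"
  where "iterates f = range (\<lambda>i. ((\<lambda>n. runmax f n + n + 1) ^^ i) 0)"

lemma iterates_gap:
  assumes "m \<in> iterates f" "m' \<in> iterates f" "m < m'" "n \<le> m"
  shows "f n \<le> m'"
proof -
  define G where "G n = runmax f n + n + 1" for n
  have sm: "strict_mono (\<lambda>i. (G ^^ i) 0)"
    by (rule strict_mono_Suc_iff[THEN iffD2]) (simp add: G_def)
  obtain i j where ij: "m = (G ^^ i) 0" "m' = (G ^^ j) 0"
    using assms unfolding iterates_def G_def by auto
  with sm assms(3) have "Suc i \<le> j" using strict_mono_less[OF sm, of i j] by simp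
  then have "(G ^^ Suc i) 0 \<le> m'" using strict_mono_less_eq[OF sm, of "Suc i" j] ij by simp
  then show ?thesis using runmax_ge[OF assms(4), of f] ij by (simp add: G_def)
qed

lemma infinite_iterates: "infinite (iterates f)"
proof -
  have "strict_mono (\<lambda>i. ((\<lambda>n. runmax f n + n + 1) ^^ i) 0)"
    by (rule strict_mono_Suc_iff[THEN iffD2]) simp
  then show ?thesis unfolding iterates_def
    using strict_mono_imp_inj_on range_inj_infinite by blast
qed

text \<open>Choose \<open>g\<close> not eventually below any \<open>T f\<close>. If
  \<open>iterates g\<close> met \<open>[n, f n)\<close> for all large \<open>n\<close>, it would
  have an element \<open>m\<close> there and a further \<open>m'\<close> in
  \<open>[m + 1, f (m + 1))\<close>. Then \<open>g n \<le> m' < f (m + 1)\<close>, and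
  \<open>m + 1 \<le> f n\<close> bounds this by \<open>T f n\<close>, so \<open>g\<close> would be
  eventually below \<open>T f\<close>.\<close>

lemma exists_often_gap:
  assumes "small \<Phi>"
  shows "\<exists>x. infinite x \<and> (\<forall>f\<in>\<Phi>. often_gap x f)"
proof -
  define T where "T f n = runmax f (f n)" for f :: "nat \<Rightarrow> nat" and n
  have "\<not> dominating (T ` \<Phi>)"
    using assms by (simp add: small_image small_not_dominating)
  then obtain g where g: "\<And>f. f \<in> \<Phi> \<Longrightarrow> \<not> g \<le>* T f"
    unfolding dominating_def by blast
  have "often_gap (iterates g) f" if "f \<in> \<Phi>" for f
  proof (rule ccontr)
    assume "\<not> often_gap (iterates g) f"
    then have "finite {n. iterates g \<inter> {n..<f n} = {}}" by (simp add: often_gap_def)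
    then obtain N where N: "\<And>n. n \<ge> N \<Longrightarrow> iterates g \<inter> {n..<f n} \<noteq> {}"
      by (metis (mono_tags, lifting) infinite_nat_iff_unbounded_le mem_Collect_eq finite_nat_set_iff_bounded leD)
    have "g n \<le> T f n" if n: "n \<ge> N" for n
    proof -
      obtain m where m: "m \<in> iterates g" "n \<le> m" "m < f n" using N[OF n] by auto
      have "Suc m \<ge> N" using n m by simp
      from N[OF this] obtain m' where m': "m' \<in> iterates g" "m < m'" "m' < f (Suc m)"
        by (auto simp: Suc_le_eq)
      have "g n \<le> m'" using iterates_gap m m' by blast
      also have "m' \<le> T f n" using m' runmax_ge[of "Suc m" "f n" f] m by (simp add: T_def)
      finally show ?thesis .
    qed
    then have "g \<le>* T f" unfolding le_star_def eventually_sequentially by blast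
    with g[OF that] show False by simp
  qed
  then show ?thesis using infinite_iterates by blast
qed

text \<open>This is b = d: no unbounded set has fewer than d elements.\<close>

definition small_bounded :: bool
  where "small_bounded \<longleftrightarrow> (\<forall>\<Phi>. small \<Phi> \<longrightarrow> (\<exists>g. \<forall>f\<in>\<Phi>. f \<le>* g))"

text \<open>For each \<open>f\<close> the functions not eventually above \<open>f\<close> do not
  dominate \<open>f\<close>. A function \<open>g\<close> witnessing that the union of these sets
  over \<Phi> is not dominating lies outside the union, because \<open>g \<le>* g\<close>; so it
  bounds \<Phi>.\<close>

lemma small_boundedI:
  assumes "\<And>\<F> :: (nat \<Rightarrow> nat) set set. small \<F> \<Longrightarrow> \<forall>Y\<in>\<F>. \<not> dominating Y \<Longrightarrow> \<not> dominating (\<Union>\<F>)"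
  shows small_bounded
  unfolding small_bounded_def
proof (intro allI impI)
  fix \<Phi> :: "(nat \<Rightarrow> nat) set" assume "small \<Phi>"
  define Y where "Y f = {h. \<not> f \<le>* h}" for f
  have "\<not> dominating (Y f)" for f unfolding dominating_def Y_def by blast
  then have "\<not> dominating (\<Union>(Y ` \<Phi>))" using assms \<open>small \<Phi>\<close> small_image by blast
  then obtain g where g: "\<And>h. h \<in> \<Union>(Y ` \<Phi>) \<Longrightarrow> \<not> g \<le>* h" unfolding dominating_def by blast
  have "g \<le>* g" by (simp add: le_star_def)
  with g have "g \<notin> \<Union>(Y ` \<Phi>)" by blast
  then show "\<exists>g. \<forall>f\<in>\<Phi>. f \<le>* g" unfolding Y_def by blast
qed

text \<open>The orbit of a common bound \<open>g\<close> leaves, after each late element, a gap at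
  least as long as every \<open>f\<close> of the family asks for.\<close>

lemma exists_thin:
  assumes small_bounded "small \<Phi>"
  shows "\<exists>x. infinite x \<and> (\<forall>f\<in>\<Phi>. thin x f)"
proof -
  obtain g where g: "\<And>f. f \<in> \<Phi> \<Longrightarrow> f \<le>* g" using assms unfolding small_bounded_def by blast
  have "thin (iterates g) f" if f: "f \<in> \<Phi>" for f
  proof -
    obtain N where "\<forall>n\<ge>N. f n \<le> g n"
      using g[OF f] unfolding le_star_def eventually_sequentially by blast
    then show ?thesis unfolding thin_def using iterates_gap by (meson order_refl order_trans)
  qed
  then show ?thesis using infinite_iterates by blast
qed

section \<open>Sparse families from the two cases of the axiom\<close>

definition gaps :: "nat set set \<Rightarrow> (nat \<Rightarrow> nat) \<Rightarrow> nat set"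
  where "gaps S f = {n. \<forall>x\<in>S. x \<inter> {n..<f n} = {}}"

text \<open>The interface between \<open>Ax\<close> and topology, shared by both cases.
  \<open>guess\<close> yields the selections; \<open>sparse\<close> puts into \<open>I\<close> the
  functions controlled by \<open>h\<close> on common gaps of finitely many unexceptional members of
  \<open>M\<close>. The exceptional set \<open>E\<close> depends on \<open>h\<close> alone, whereas
  the finite set \<open>S\<close> may vary with the function.\<close>

locale small_ideal =
  fixes I :: "(nat \<Rightarrow> nat) set set" and M :: "nat set set"
  assumes infinite_elem: "x \<in> M \<Longrightarrow> infinite x"
    and Union_closed: "small \<F> \<Longrightarrow> \<F> \<subseteq> I \<Longrightarrow> \<Union>\<F> \<in> I"
    and guess: "Y \<in> I \<Longrightarrow> \<exists>g. \<forall>F N. finite F \<and> F \<subseteq> Y \<longrightarrow> (\<exists>n\<ge>N. \<forall>f\<in>F. f n \<le> g n)"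
    and sparse: "mono h \<Longrightarrow> (\<And>n. n < h n) \<Longrightarrow> \<exists>E. small E \<and>
      (\<forall>Y. (\<forall>f\<in>Y. mono f \<and> (\<exists>S. finite S \<and> S \<subseteq> M - E \<and> (\<forall>n\<in>gaps S h. f n \<le> h n))) \<longrightarrow> Y \<in> I)"

text \<open>The ideal and the exceptional sets stay the same. This allows the later passage to a
  subfamily whose group is not \<sigma>-compact.\<close>

lemma small_ideal_subset: "small_ideal I M \<Longrightarrow> M' \<subseteq> M \<Longrightarrow> small_ideal I M'"
proof (unfold_locales, goal_cases)
  case (4 h)
  then interpret small_ideal I M by simp
  obtain E where E: "small E"
    "\<And>Y. \<forall>f\<in>Y. mono f \<and> (\<exists>S. finite S \<and> S \<subseteq> M - E \<and> (\<forall>n\<in>gaps S h. f n \<le> h n)) \<Longrightarrow> Y \<in> I"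
    using sparse[OF 4(3,4)] by blast
  show ?case
  proof (intro exI[of _ E] conjI allI impI E(1) E(2))
    fix Y assume Y: "\<forall>f\<in>Y. mono f \<and> (\<exists>S. finite S \<and> S \<subseteq> M' - E \<and> (\<forall>n\<in>gaps S h. f n \<le> h n))"
    have "M' - E \<subseteq> M - E" using \<open>M' \<subseteq> M\<close> by blast
    with Y show "\<forall>f\<in>Y. mono f \<and> (\<exists>S. finite S \<and> S \<subseteq> M - E \<and> (\<forall>n\<in>gaps S h. f n \<le> h n))"
      by (meson subset_trans)
  qed
qed (auto simp: small_ideal_def)

section \<open>Recursion along a well-order of type d\<close>

lemma wf_card_of: "wf ( |D| - Id)"
  using card_of_well_order_on well_order_on_def by blast

lemma card_of_linear:
  "\<alpha> \<in> D \<Longrightarrow> \<beta> \<in> D \<Longrightarrow> \<alpha> \<in> underS |D| \<beta> \<or> \<alpha> = \<beta> \<or> \<beta> \<in> underS |D| \<alpha>"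
  using card_of_well_order_on[of D]
  unfolding well_order_on_def linear_order_on_def total_on_def underS_def by auto

lemma underS_card_of_trans:
  "\<alpha> \<in> underS |D| \<beta> \<Longrightarrow> \<beta> \<in> underS |D| \<gamma> \<Longrightarrow> \<alpha> \<in> underS |D| \<gamma>"
  using card_of_well_order_on[of D]
  unfolding well_order_on_def linear_order_on_def partial_order_on_def preorder_on_def
    trans_def antisym_def underS_def by blast

lemma small_underS:
  assumes "dominating_number = |D|" "\<alpha> \<in> D"
  shows "small (underS |D| \<alpha>)"
  using card_of_underS[OF card_of_Card_order, of \<alpha> D] assms(2)
  unfolding small_def assms(1) Field_card_of .

lemma card_of_max:
  assumes "finite T" "T \<noteq> {}" "T \<subseteq> D"
  shows "\<exists>\<delta>\<in>T. \<forall>\<alpha>\<in>T. \<alpha> \<noteq> \<delta> \<longrightarrow> \<alpha> \<in> underS |D| \<delta>"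
  using assms
proof (induction T rule: finite_ne_induct)
  case (insert \<beta> T)
  then obtain \<delta> where \<delta>: "\<delta> \<in> T" "\<And>\<alpha>. \<alpha> \<in> T \<Longrightarrow> \<alpha> \<noteq> \<delta> \<Longrightarrow> \<alpha> \<in> underS |D| \<delta>" by auto
  then have "\<beta> \<in> underS |D| \<delta> \<or> \<beta> = \<delta> \<or> \<delta> \<in> underS |D| \<beta>"
    using insert.prems by (intro card_of_linear) auto
  then show ?case
  proof (elim disjE)
    assume "\<delta> \<in> underS |D| \<beta>"
    then have "\<forall>\<alpha>\<in>T. \<alpha> \<in> underS |D| \<beta>" using \<delta> underS_card_of_trans by metis
    then show ?thesis by auto
  qed (use \<delta> in auto)
qed auto

text \<open>No infinite \<open>x\<close> satisfies \<open>R x (jump x)\<close>, so adding \<open>jump\<close> of the earlier terms to the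
  requirements makes the sequence injective.\<close>

lemma exists_sequence:
  fixes R :: "nat set \<Rightarrow> (nat \<Rightarrow> nat) \<Rightarrow> bool"
    and \<Phi> :: "((nat \<Rightarrow> nat) \<Rightarrow> nat set) \<Rightarrow> (nat \<Rightarrow> nat) \<Rightarrow> (nat \<Rightarrow> nat) set"
  assumes D: "dominating_number = |D|"
    and R: "\<And>\<Phi>. small \<Phi> \<Longrightarrow> \<exists>x. infinite x \<and> (\<forall>f\<in>\<Phi>. R x f)"
    and jump: "\<And>x. infinite x \<Longrightarrow> \<not> R x (jump x)"
    and small: "\<And>\<xi> \<beta>. \<beta> \<in> D \<Longrightarrow> small (\<Phi> \<xi> \<beta>)"
    and cong: "\<And>\<xi> \<xi>' \<beta>. (\<And>\<alpha>. \<alpha> \<in> underS |D| \<beta> \<Longrightarrow> \<xi> \<alpha> = \<xi>' \<alpha>) \<Longrightarrow> \<Phi> \<xi> \<beta> = \<Phi> \<xi>' \<beta>"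
  shows "\<exists>\<xi>. inj_on \<xi> D \<and> (\<forall>\<beta>\<in>D. infinite (\<xi> \<beta>) \<and> (\<forall>f\<in>\<Phi> \<xi> \<beta>. R (\<xi> \<beta>) f))"
proof -
  \<comment> \<open>The choice principle runs over the whole type, so the guard
    \<open>\<beta> \<in> D\<close> leaves the values outside \<open>D\<close> arbitrary.\<close>
  define P where "P \<xi> \<beta> x \<longleftrightarrow> (\<beta> \<in> D \<longrightarrow> infinite x \<and>
    (\<forall>f\<in>\<Phi> \<xi> \<beta> \<union> (\<lambda>\<alpha>. jump (\<xi> \<alpha>)) ` underS |D| \<beta>. R x f))" for \<xi> :: "(nat \<Rightarrow> nat) \<Rightarrow> nat set" and \<beta> x
  have "\<exists>\<xi>. \<forall>\<beta>. P \<xi> \<beta> (\<xi> \<beta>)"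
  proof (rule dependent_wf_choice[OF wf_card_of[of D]])
    fix \<xi> \<xi>' :: "(nat \<Rightarrow> nat) \<Rightarrow> nat set" and \<beta> x
    assume eq: "\<And>\<alpha>. (\<alpha>, \<beta>) \<in> |D| - Id \<Longrightarrow> \<xi> \<alpha> = \<xi>' \<alpha>"
    then have "\<And>\<alpha>. \<alpha> \<in> underS |D| \<beta> \<Longrightarrow> \<xi> \<alpha> = \<xi>' \<alpha>" by (simp add: underS_def)
    with cong[of \<beta> \<xi> \<xi>'] show "P \<xi> \<beta> x = P \<xi>' \<beta> x" unfolding P_def by auto
  next
    fix \<xi> :: "(nat \<Rightarrow> nat) \<Rightarrow> nat set" and \<beta>
    show "\<exists>x. P \<xi> \<beta> x"
    proof (cases "\<beta> \<in> D")
      case True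
      then have "small (\<Phi> \<xi> \<beta> \<union> (\<lambda>\<alpha>. jump (\<xi> \<alpha>)) ` underS |D| \<beta>)"
        by (intro small_Un small small_image small_underS[OF D])
      from R[OF this] show ?thesis unfolding P_def by blast
    qed (simp add: P_def)
  qed
  then obtain \<xi> where \<xi>: "\<And>\<beta>. P \<xi> \<beta> (\<xi> \<beta>)" by blast
  have neq: "\<xi> \<alpha> \<noteq> \<xi> \<beta>" if "\<alpha> \<in> underS |D| \<beta>" "\<beta> \<in> D" for \<alpha> \<beta>
  proof
    assume eq: "\<xi> \<alpha> = \<xi> \<beta>"
    have "infinite (\<xi> \<beta>)" "R (\<xi> \<beta>) (jump (\<xi> \<alpha>))" using \<xi>[of \<beta>] that unfolding P_def by auto
    then show False using jump[of "\<xi> \<beta>"] unfolding eq by simp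
  qed
  have "inj_on \<xi> D"
    using neq card_of_linear by (metis inj_onI)
  moreover have "infinite (\<xi> \<beta>) \<and> (\<forall>f\<in>\<Phi> \<xi> \<beta>. R (\<xi> \<beta>) f)" if "\<beta> \<in> D" for \<beta>
    using \<xi>[of \<beta>] that unfolding P_def by auto
  ultimately show ?thesis by blast
qed

section \<open>The first case: bounded sets\<close>

lemma le_star_iff: "f \<le>* g \<longleftrightarrow> (\<exists>N. \<forall>n\<ge>N. f n \<le> g n)"
  by (simp add: le_star_def eventually_sequentially)

lemma le_star_trans: "f \<le>* g \<Longrightarrow> g \<le>* h \<Longrightarrow> f \<le>* h"
  unfolding le_star_iff by (meson le_trans nat_le_linear)

text \<open>Pigeonhole: each \<open>x \<in> S\<close> eventually has at most one element in \<open>[n, h\<^sup>n\<^sup>+\<^sup>1(n))\<close>, hence meets at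
  most one of the \<open>n + 1 > card S\<close> intervals \<open>[h\<^sup>i(n), h\<^sup>i\<^sup>+\<^sup>1(n))\<close>.\<close>

lemma thin_avoids:
  assumes thin: "\<And>x. x \<in> S \<Longrightarrow> thin x f" and S: "finite S"
    and h: "\<And>n::nat. n < h n" and f: "runmax (\<lambda>n. (h ^^ Suc n) n) \<le>* f"
  shows "\<exists>N. \<forall>n\<ge>N. \<exists>i\<le>n. (h ^^ i) n \<in> gaps S h"
proof -
  define H where "H n = (h ^^ Suc n) n" for n
  have "\<forall>x\<in>S. \<exists>N. \<forall>m\<in>x. \<forall>m'\<in>x. N \<le> m \<and> m < m' \<longrightarrow> f m \<le> m'"
    using thin unfolding thin_def by blast
  then obtain b where b: "\<And>x m m'. x \<in> S \<Longrightarrow> m \<in> x \<Longrightarrow> m' \<in> x \<Longrightarrow> b x \<le> m \<Longrightarrow> m < m' \<Longrightarrow> f m \<le> m'"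
    by metis
  obtain N0 where N0: "\<And>n. n \<ge> N0 \<Longrightarrow> runmax H n \<le> f n"
    using f unfolding le_star_iff H_def by blast
  \<comment> \<open>Beyond \<open>N\<close> three things hold: \<open>f\<close> is above the running
    maximum of \<open>H\<close>, there are more intervals than sets in \<open>S\<close>, and every
    set has passed its threshold for thinness.\<close>
  define N where "N = N0 + card S + Max (insert 0 (b ` S))"
  have "b x \<le> Max (insert 0 (b ` S))" if "x \<in> S" for x using S that by (intro Max_ge) auto
  then have N: "N0 \<le> N" "card S \<le> N" "\<And>x. x \<in> S \<Longrightarrow> b x \<le> N"
    unfolding N_def by (auto intro: trans_le_add2)
  have "\<exists>i\<le>n. (h ^^ i) n \<in> gaps S h" if n: "n \<ge> N" for n
  proof (rule ccontr)
    define a where "a i = (h ^^ i) n" for i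
    have a: "strict_mono a"
      by (rule strict_mono_Suc_iff[THEN iffD2]) (simp add: a_def h)
    assume "\<not> ?thesis"
    then have "\<forall>i\<in>{..n}. \<exists>x\<in>S. \<exists>m\<in>x. a i \<le> m \<and> m < a (Suc i)"
      unfolding gaps_def a_def by fastforce
    then obtain c where c: "\<And>i. i \<le> n \<Longrightarrow> c i \<in> S \<and> (\<exists>m\<in>c i. a i \<le> m \<and> m < a (Suc i))"
      by (metis atMost_iff)
    have "card (c ` {..n}) \<le> card S" using c S by (intro card_mono) auto
    then have "\<not> inj_on c {..n}" using N n by (intro pigeonhole) simp
    then obtain i j where ij: "i < j" "j \<le> n" "c i = c j"
      unfolding inj_on_def by (metis atMost_iff linorder_neqE_nat)
    obtain m m' where m: "m \<in> c i" "a i \<le> m" "m < a (Suc i)" "m' \<in> c i" "a j \<le> m'" "m' < a (Suc j)"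
      using c[of i] c[of j] ij by auto
    have "a (Suc i) \<le> a j" using ij strict_mono_less_eq[OF a] by simp
    then have "m < m'" using m by linarith
    have "a 0 \<le> a i" using strict_mono_less_eq[OF a] by simp
    then have "n \<le> m" using m by (simp add: a_def)
    then have "b (c i) \<le> m" using N(3)[of "c i"] c[of i] ij n by simp
    then have "f m \<le> m'" using b[of "c i" m m'] c[of i] ij m \<open>m < m'\<close> by simp
    \<comment> \<open>Here \<open>f\<close> is taken at \<open>m\<close> but compared with
      \<open>H\<close> at the earlier point \<open>n\<close>; this is why the hypothesis speaks of
      the running maximum. As \<open>H n\<close> is the right end of the last interval,
      \<open>m'\<close> would lie beyond all intervals.\<close>
    moreover have "H n \<le> f m"
      using runmax_ge[OF \<open>n \<le> m\<close>, of H] N0[of m] N n \<open>n \<le> m\<close> by linarith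
    moreover have "a (Suc j) \<le> a (Suc n)" using ij strict_mono_less_eq[OF a] by simp
    ultimately show False using m by (simp add: H_def a_def)
  qed
  then show ?thesis by blast
qed

text \<open>The ideal consists of the \<open>\<le>*\<close>-bounded sets. Along a dominating family
  \<open>D\<close> ordered in type d, the \<beta>-th set is thin for all functions of
  \<open>D\<close> before \<beta>. Given \<open>h\<close>, some \<gamma> in \<open>D\<close> is
  eventually above the running maximum of \<open>H\<close>, and only the sets with index up to
  \<gamma> are exceptional. Since \<open>H\<close> depends on \<open>h\<close> alone, it bounds all
  the functions at once.\<close>

lemma small_ideal_bounded:
  assumes small_bounded
  shows "\<exists>I M. small_ideal I M \<and> |M| =o dominating_number"
proof -
  obtain D where dom: "dominating D" and D: "dominating_number = |D|" "uncountable D"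
    by (rule dominating_number_eq_card_of)
  define I where "I = {Y. \<exists>g. \<forall>f\<in>Y. f \<le>* g}"
  obtain \<xi> where \<xi>: "inj_on \<xi> D" "\<forall>\<beta>\<in>D. infinite (\<xi> \<beta>) \<and> (\<forall>f\<in>underS |D| \<beta>. thin (\<xi> \<beta>) f)"
    using exists_sequence[OF D(1), of thin "\<lambda>_ \<beta>. underS |D| \<beta>"] exists_thin[OF assms] thin_jump
      small_underS[OF D(1)] by blast
  have "small_ideal I (\<xi> ` D)"
  proof (unfold_locales, goal_cases)
    case (1 x)
    then show ?case using \<xi> by blast
  next
    case (2 \<F>)
    then obtain g where g: "\<And>Y f. Y \<in> \<F> \<Longrightarrow> f \<in> Y \<Longrightarrow> f \<le>* g Y" unfolding I_def by (simp add: subset_iff) metis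
    obtain b where "\<And>Y. Y \<in> \<F> \<Longrightarrow> g Y \<le>* b"
      using assms small_image[OF \<open>small \<F>\<close>, of g] unfolding small_bounded_def by blast
    with g show ?case unfolding I_def using le_star_trans by blast
  next
    case (3 Y)
    then obtain g where g: "\<And>f. f \<in> Y \<Longrightarrow> f \<le>* g" unfolding I_def by blast
    have "\<exists>n\<ge>N. \<forall>f\<in>F. f n \<le> g n" if "finite F" "F \<subseteq> Y" for F N
    proof -
      have "\<forall>\<^sub>F n in sequentially. \<forall>f\<in>F. f n \<le> g n"
        using that g unfolding le_star_def by (intro eventually_ball_finite) auto
      then obtain K where "\<And>n. n \<ge> K \<Longrightarrow> \<forall>f\<in>F. f n \<le> g n" unfolding eventually_sequentially by blast
      then show ?thesis by (intro exI[of _ "max K N"]) auto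
    qed
    then show ?case by blast
  next
    case (4 h)
    define H where "H n = (h ^^ Suc n) n" for n
    obtain \<gamma> where \<gamma>: "\<gamma> \<in> D" "runmax H \<le>* \<gamma>" using dom unfolding dominating_def by blast
    define E where "E = \<xi> ` (underS |D| \<gamma> \<union> {\<gamma>})"
    have "small E" unfolding E_def
      by (intro small_image small_Un small_underS[OF D(1)] \<gamma>(1) countable_imp_small) auto
    moreover have "f \<le>* H" if "mono f" "finite S" "S \<subseteq> \<xi> ` D - E" "\<forall>n\<in>gaps S h. f n \<le> h n" for f S
    proof -
      have "thin x \<gamma>" if x: "x \<in> S" for x
      proof -
        obtain \<alpha> where \<alpha>: "x = \<xi> \<alpha>" "\<alpha> \<in> D" "\<alpha> \<notin> underS |D| \<gamma>" "\<alpha> \<noteq> \<gamma>"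
          using x \<open>S \<subseteq> \<xi> ` D - E\<close> unfolding E_def by auto
        from card_of_linear[OF \<alpha>(2) \<gamma>(1)] \<alpha>(3,4) have "\<gamma> \<in> underS |D| \<alpha>" by simp
        then have "thin (\<xi> \<alpha>) \<gamma>" using \<xi>(2)[THEN bspec, OF \<alpha>(2)] by simp
        then show ?thesis by (simp only: \<alpha>(1))
      qed
      then have "\<exists>N. \<forall>n\<ge>N. \<exists>i\<le>n. (h ^^ i) n \<in> gaps S h"
        using \<open>finite S\<close> 4(2) \<gamma>(2) unfolding H_def by (rule thin_avoids)
      then obtain N where N: "\<And>n. n \<ge> N \<Longrightarrow> \<exists>i\<le>n. (h ^^ i) n \<in> gaps S h" by metis
      have "f n \<le> H n" if n: "n \<ge> N" for n
      proof -
        have a: "strict_mono (\<lambda>i. (h ^^ i) n)"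
          by (rule strict_mono_Suc_iff[THEN iffD2]) (simp add: 4)
        obtain i where i: "i \<le> n" "(h ^^ i) n \<in> gaps S h" using N n by blast
        \<comment> \<open>The bound is known at the gap \<open>(h ^^ i) n\<close> only; monotonicity
          of \<open>f\<close> carries it back to \<open>n\<close>.\<close>
        have "n \<le> (h ^^ i) n" using strict_mono_less_eq[OF a, of 0 i] by simp
        then have "f n \<le> f ((h ^^ i) n)" using \<open>mono f\<close> by (simp add: monoD)
        also have "\<dots> \<le> (h ^^ Suc i) n" using i that \<open>\<forall>n\<in>gaps S h. f n \<le> h n\<close> by simp
        also have "\<dots> \<le> H n" unfolding H_def using i strict_mono_less_eq[OF a, of "Suc i" "Suc n"] by simp
        finally show ?thesis .
      qed
      then show ?thesis unfolding le_star_iff by blast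
    qed
    ultimately show ?case unfolding I_def by (intro exI[of _ E]) blast
  qed
  moreover have "|\<xi> ` D| =o dominating_number"
    unfolding D(1) using \<xi>(1) by (meson bij_betw_imageI card_of_ordIsoI ordIso_symmetric)
  ultimately show ?thesis by blast
qed

section \<open>The second case: sets that are not finitely dominating\<close>

lemma not_finitely_dominating_iff:
  "\<not> finitely_dominating Y \<longleftrightarrow>
    (\<exists>g. \<forall>F N. finite F \<and> F \<subseteq> Y \<longrightarrow> (\<exists>n\<ge>N. \<forall>f\<in>F. f n < g n))"
proof -
  have freq: "(\<not> (\<forall>\<^sub>F n in sequentially. g n \<le> Max ((\<lambda>f. f n) ` F))) \<longleftrightarrow> (\<forall>N. \<exists>n\<ge>N. \<forall>f\<in>F. f n < g n)"
    if "finite F" "F \<noteq> {}" for F :: "(nat \<Rightarrow> nat) set" and g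
    using that by (simp add: eventually_sequentially not_le Max_less_iff)
  have "(\<not> finitely_dominating Y) \<longleftrightarrow>
    (\<exists>g. \<forall>F. finite F \<and> F \<noteq> {} \<and> F \<subseteq> Y \<longrightarrow>
      (\<not> (\<forall>\<^sub>F n in sequentially. g n \<le> Max ((\<lambda>f. f n) ` F))))"
    unfolding finitely_dominating_def
    by (simp only: not_all not_ex de_Morgan_conj imp_conv_disj not_not disj_assoc)
  also have "\<dots> \<longleftrightarrow>
    (\<exists>g. \<forall>F. finite F \<and> F \<noteq> {} \<and> F \<subseteq> Y \<longrightarrow> (\<forall>N. \<exists>n\<ge>N. \<forall>f\<in>F. f n < g n))"
    by (intro ex_cong1 all_cong1 imp_cong refl freq) auto
  also have "\<dots> \<longleftrightarrow> (\<exists>g. \<forall>F N. finite F \<and> F \<subseteq> Y \<longrightarrow> (\<exists>n\<ge>N. \<forall>f\<in>F. f n < g n))"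
  proof (intro iff_exI iffI allI impI, elim conjE)
    fix g F N
    assume "\<forall>F. finite F \<and> F \<noteq> {} \<and> F \<subseteq> Y \<longrightarrow> (\<forall>N. \<exists>n\<ge>N. \<forall>f\<in>F. f n < g n)" "finite F" "F \<subseteq> Y"
    then show "\<exists>n\<ge>N. \<forall>f\<in>F. f n < g n" by (cases "F = {}") auto
  qed blast
  finally show ?thesis .
qed

text \<open>The ideal consists of the sets of monotone functions that some \<open>g\<close> guesses.
  The recursion makes every finite set of members with index after \<gamma> have infinitely many
  common gaps for \<gamma>, and at such a gap \<open>h\<close> itself bounds finitely many functions
  simultaneously.\<close>

lemma small_ideal_not_finitely_dominating:
  assumes Ax: "\<And>\<F>. small \<F> \<Longrightarrow>
      \<forall>Y\<in>\<F>. (\<forall>f\<in>Y. strict_mono f) \<and> \<not> finitely_dominating Y \<Longrightarrow> \<not> finitely_dominating (\<Union>\<F>)"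
  shows "\<exists>I M. small_ideal I M \<and> |M| =o dominating_number"
proof -
  obtain D where dom: "dominating D" and D: "dominating_number = |D|" "uncountable D"
    by (rule dominating_number_eq_card_of)
  define good where "good Y \<longleftrightarrow>
    (\<exists>g. \<forall>F N. finite F \<and> F \<subseteq> Y \<longrightarrow> (\<exists>n\<ge>N. \<forall>f\<in>F. f n \<le> g n))" for Y :: "(nat \<Rightarrow> nat) set"
  define I where "I = {Y. (\<forall>f\<in>Y. mono f) \<and> good Y}"
  \<comment> \<open>Adding the identity turns monotone functions into strictly increasing ones, as
    the second case of \<open>Ax\<close> demands, and does not affect whether a set is
    \<open>good\<close>.\<close>
  define s :: "(nat \<Rightarrow> nat) \<Rightarrow> nat \<Rightarrow> nat" where "s f n = f n + n" for f n
  have s: "good Y \<longleftrightarrow> \<not> finitely_dominating (s ` Y)" for Y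
  proof
    assume "good Y"
    then obtain g where g: "\<forall>F N. finite F \<and> F \<subseteq> Y \<longrightarrow> (\<exists>n\<ge>N. \<forall>f\<in>F. f n \<le> g n)"
      unfolding good_def by (rule exE)
    have "\<exists>n\<ge>N. \<forall>f\<in>F. f n < g n + n + 1" if F: "finite F" "F \<subseteq> s ` Y" for F N
    proof -
      obtain F' where F': "F' \<subseteq> Y" "finite F'" "F = s ` F'" using F finite_subset_image by metis
      then obtain n where n: "n \<ge> N" "\<forall>f\<in>F'. f n \<le> g n" using g by metis
      have "f n < g n + n + 1" if "f \<in> F" for f
        using that n(2) F'(3) by (force simp: s_def less_Suc_eq_le)
      then show ?thesis using n(1) by metis
    qed
    then show "\<not> finitely_dominating (s ` Y)" unfolding not_finitely_dominating_iff
      by (intro exI[of _ "\<lambda>n. g n + n + 1"]) blast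
  next
    assume "\<not> finitely_dominating (s ` Y)"
    then obtain g where g: "\<forall>F N. finite F \<and> F \<subseteq> s ` Y \<longrightarrow> (\<exists>n\<ge>N. \<forall>f\<in>F. f n < g n)"
      unfolding not_finitely_dominating_iff by (rule exE)
    have "\<exists>n\<ge>N. \<forall>f\<in>F. f n \<le> g n" if F: "finite F" "F \<subseteq> Y" for F N
    proof -
      have "finite (s ` F)" "s ` F \<subseteq> s ` Y" using F by auto
      with g obtain n where n: "n \<ge> N" "\<And>f. f \<in> F \<Longrightarrow> s f n < g n" by (metis imageI)
      have "f n \<le> g n" if "f \<in> F" for f using n(2)[OF that] by (simp add: s_def)
      then show ?thesis using n by blast
    qed
    then show "good Y" unfolding good_def by (intro exI[of _ g]) blast
  qed
  \<comment> \<open>A gap \<open>[n, \<gamma> m)\<close> with \<open>m = next_in A n\<close> contains \<open>[m, \<gamma> m)\<close>, so a set with infinitely many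
    such gaps keeps infinitely many elements of \<open>A\<close>.\<close>
  define \<Phi> where "\<Phi> \<xi> \<beta> = (\<lambda>(\<gamma>, T) n. \<gamma> (next_in (gaps (\<xi> ` T) \<gamma>) n)) `
      (underS |D| \<beta> \<times> {T. finite T \<and> T \<subseteq> underS |D| \<beta>})"
    for \<xi> :: "(nat \<Rightarrow> nat) \<Rightarrow> nat set" and \<beta>
  have "\<exists>\<xi>. inj_on \<xi> D \<and> (\<forall>\<beta>\<in>D. infinite (\<xi> \<beta>) \<and> (\<forall>f\<in>\<Phi> \<xi> \<beta>. often_gap (\<xi> \<beta>) f))"
  proof (rule exists_sequence[OF D(1) exists_often_gap often_gap_jump])
    fix \<xi> \<beta> assume "\<beta> \<in> D"
    then show "small (\<Phi> \<xi> \<beta>)" unfolding \<Phi>_def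
      by (intro small_image small_Times small_finite_subsets small_underS[OF D(1)])
  next
    fix \<xi> \<xi>' :: "(nat \<Rightarrow> nat) \<Rightarrow> nat set" and \<beta>
    assume "\<And>\<alpha>. \<alpha> \<in> underS |D| \<beta> \<Longrightarrow> \<xi> \<alpha> = \<xi>' \<alpha>"
    then have "\<And>T. T \<subseteq> underS |D| \<beta> \<Longrightarrow> \<xi> ` T = \<xi>' ` T" by (intro image_cong) auto
    then show "\<Phi> \<xi> \<beta> = \<Phi> \<xi>' \<beta>" unfolding \<Phi>_def by (intro image_cong) auto
  qed
  then obtain \<xi> where \<xi>: "inj_on \<xi> D" "\<And>\<beta>. \<beta> \<in> D \<Longrightarrow> infinite (\<xi> \<beta>)"
    "\<And>\<beta> f. \<beta> \<in> D \<Longrightarrow> f \<in> \<Phi> \<xi> \<beta> \<Longrightarrow> often_gap (\<xi> \<beta>) f" by blast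
  \<comment> \<open>Induction removes the last index \<delta> of \<open>T\<close>. The common gaps
    of the remaining sets form an infinite set \<open>A\<close>, and the recursion required of
    \<open>\<xi> \<delta>\<close> infinitely many gaps for the function built from \<gamma> and
    \<open>A\<close>.\<close>
  have inf: "infinite (gaps (\<xi> ` T) \<gamma>)"
    if "finite T" "T \<subseteq> D" "\<And>\<delta>. \<delta> \<in> T \<Longrightarrow> \<gamma> \<in> underS |D| \<delta>" for T \<gamma>
    using that
  proof (induction "card T" arbitrary: T)
    case 0
    then show ?case by (simp add: gaps_def)
  next
    case (Suc k)
    then have "T \<noteq> {}" by auto
    then obtain \<delta> where \<delta>: "\<delta> \<in> T" "\<And>\<alpha>. \<alpha> \<in> T \<Longrightarrow> \<alpha> \<noteq> \<delta> \<Longrightarrow> \<alpha> \<in> underS |D| \<delta>"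
      using card_of_max Suc.prems by metis
    define A where "A = gaps (\<xi> ` (T - {\<delta>})) \<gamma>"
    have A: "infinite A" unfolding A_def using Suc \<delta>(1) by (intro Suc.hyps(1)) auto
    have "(\<lambda>n. \<gamma> (next_in A n)) \<in> \<Phi> \<xi> \<delta>"
      unfolding \<Phi>_def A_def using Suc.prems \<delta> by (intro image_eqI[of _ _ "(\<gamma>, T - {\<delta>})"]) auto
    then have og: "infinite {n. \<xi> \<delta> \<inter> {n..<\<gamma> (next_in A n)} = {}}"
      using \<xi>(3)[of \<delta>] \<delta>(1) Suc.prems unfolding often_gap_def by blast
    show ?case unfolding infinite_nat_iff_unbounded_le
    proof
      fix N
      obtain n where n: "n \<ge> N" "\<xi> \<delta> \<inter> {n..<\<gamma> (next_in A n)} = {}"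
        using og unfolding infinite_nat_iff_unbounded_le by blast
      have "\<xi> \<delta> \<inter> {next_in A n..<\<gamma> (next_in A n)} = {}"
        using n(2) next_in(2)[OF A, of n] by fastforce
      then have "next_in A n \<in> gaps (\<xi> ` T) \<gamma>"
        using next_in(1)[OF A, of n] unfolding A_def gaps_def by auto
      then show "\<exists>m\<ge>N. m \<in> gaps (\<xi> ` T) \<gamma>" using n(1) next_in(2)[OF A, of n] order_trans by blast
    qed
  qed
  have "small_ideal I (\<xi> ` D)"
  proof (unfold_locales, goal_cases)
    case (1 x)
    then show ?case using \<xi> by blast
  next
    case (2 \<F>)
    have "\<not> finitely_dominating (\<Union>((\<lambda>Y. s ` Y) ` \<F>))"
    proof (rule Ax)
      show "small ((`) s ` \<F>)" using 2 by (simp add: small_image)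
      have "strict_mono (s f)" if "mono f" for f
        using that unfolding s_def strict_mono_Suc_iff by (simp add: incseq_SucD le_imp_less_Suc)
      then show "\<forall>Y\<in>(`) s ` \<F>. (\<forall>f\<in>Y. strict_mono f) \<and> \<not> finitely_dominating Y"
        using 2 s unfolding I_def by auto
    qed
    also have "\<Union>((\<lambda>Y. s ` Y) ` \<F>) = s ` \<Union>\<F>" by blast
    finally show ?case using 2 s unfolding I_def by blast
  next
    case (3 Y)
    then show ?case unfolding I_def good_def by blast
  next
    case (4 h)
    obtain \<gamma> where \<gamma>: "\<gamma> \<in> D" "h \<le>* \<gamma>" using dom unfolding dominating_def by blast
    then obtain K where K: "\<And>n. n \<ge> K \<Longrightarrow> h n \<le> \<gamma> n" unfolding le_star_iff by blast
    define E where "E = \<xi> ` (underS |D| \<gamma> \<union> {\<gamma>})"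
    have "small E" unfolding E_def
      by (intro small_image small_Un small_underS[OF D(1)] \<gamma>(1) countable_imp_small) auto
    moreover have "Y \<in> I" if Y: "\<forall>f\<in>Y. mono f \<and>
        (\<exists>S. finite S \<and> S \<subseteq> \<xi> ` D - E \<and> (\<forall>n\<in>gaps S h. f n \<le> h n))" for Y
    proof -
      obtain S where S: "\<And>f. f \<in> Y \<Longrightarrow> finite (S f) \<and> S f \<subseteq> \<xi> ` D - E \<and> (\<forall>n\<in>gaps (S f) h. f n \<le> h n)"
        using Y by metis
      have "\<exists>n\<ge>N. \<forall>f\<in>F. f n \<le> h n" if F: "finite F" "F \<subseteq> Y" for F N
      proof -
        \<comment> \<open>The sets witnessing the finitely many members of \<open>F\<close> are
          together still finitely many, so one \<open>n\<close> is a gap for all of them.\<close>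
        have "finite (\<Union>(S ` F))" "\<Union>(S ` F) \<subseteq> \<xi> ` (D - (underS |D| \<gamma> \<union> {\<gamma>}))"
          using S F unfolding E_def by blast+
        then obtain T where T: "finite T" "T \<subseteq> D - (underS |D| \<gamma> \<union> {\<gamma>})" "\<Union>(S ` F) = \<xi> ` T"
          using finite_subset_image by metis
        have "infinite (gaps (\<xi> ` T) \<gamma>)"
          using T card_of_linear[OF \<gamma>(1)] by (intro inf) blast+
        then obtain n where n: "n \<ge> max N K" "n \<in> gaps (\<xi> ` T) \<gamma>"
          unfolding infinite_nat_iff_unbounded_le by blast
        have "n \<in> gaps (S f) h" if "f \<in> F" for f
          using n K[of n] that unfolding T(3)[symmetric] gaps_def by fastforce
        then show ?thesis using n(1) S F by (intro exI[of _ n]) auto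
      qed
      then have "good Y" unfolding good_def by (intro exI[of _ h]) blast
      moreover have "\<forall>f\<in>Y. mono f" using Y by simp
      ultimately show ?thesis unfolding I_def by simp
    qed
    ultimately show ?case by blast
  qed
  moreover have "|\<xi> ` D| =o dominating_number"
    unfolding D(1) using \<xi>(1) by (meson bij_betw_imageI card_of_ordIsoI ordIso_symmetric)
  ultimately show ?thesis by blast
qed

lemma exists_small_ideal:
  assumes Ax
  shows "\<exists>I M. small_ideal I M \<and> |M| =o dominating_number"
  using assms unfolding Ax_def small_def[symmetric]
proof
  assume "\<forall>\<F>. small \<F> \<and> (\<forall>Y\<in>\<F>. \<not> dominating Y) \<longrightarrow> \<not> dominating (\<Union>\<F>)"
  then show ?thesis by (intro small_ideal_bounded small_boundedI) blast
next
  assume "\<forall>\<F>. small \<F> \<and> (\<forall>Y\<in>\<F>. (\<forall>f\<in>Y. strict_mono f) \<and> \<not> finitely_dominating Y) \<longrightarrow>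
      \<not> finitely_dominating (\<Union>\<F>)"
  then show ?thesis by (intro small_ideal_not_finitely_dominating) blast
qed

section \<open>Selection principles\<close>

text \<open>The passage from points to functions: a bound on these functions tells how far into each
  cover a selection has to reach.\<close>

definition cover_index :: "(nat \<Rightarrow> nat \<Rightarrow> 'a set) \<Rightarrow> 'a \<Rightarrow> nat \<Rightarrow> nat"
  where "cover_index U x n = (LEAST i. x \<in> U n i)"

lemma cover_index_le: "x \<in> U n i \<Longrightarrow> cover_index U x n \<le> i"
  unfolding cover_index_def by (rule Least_le)

lemma cover_index_mem: "\<exists>i. x \<in> U n i \<Longrightarrow> x \<in> U n (cover_index U x n)"
  unfolding cover_index_def by (rule LeastI_ex)

lemma mono_cover_index:
  assumes "\<And>n. \<exists>i. x \<in> U n i" "\<And>n n' i. n \<le> n' \<Longrightarrow> U n' i \<subseteq> U n i"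
  shows "mono (cover_index U x)"
proof (rule monoI)
  fix n n' :: nat assume "n \<le> n'"
  then show "cover_index U x n \<le> cover_index U x n'"
    using assms(2)[of n n'] cover_index_mem[of x U n', OF assms(1)] by (intro cover_index_le) blast
qed

abbreviation agree :: "'i set \<Rightarrow> nat \<Rightarrow> ('i \<Rightarrow> nat set) \<Rightarrow> ('i \<Rightarrow> nat set) \<Rightarrow> bool"
  where "agree A h x y \<equiv> \<forall>a\<in>A. y a \<inter> {..<h} = x a \<inter> {..<h}"

definition tuples :: "nat set set \<Rightarrow> 'i set \<Rightarrow> ('i \<Rightarrow> nat set) set"
  where "tuples X A = {x. \<forall>a\<in>A. x a \<in> X}"

text \<open>Countably many maps from finite tuples of sets, jointly onto the space, each continuous
  when tuples are close if they agree on a long initial segment. Coordinates are indexed by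
  arbitrary finite sets, so that a power can use pairs as indices.\<close>

definition parametrizes ::
    "nat set set \<Rightarrow> 'c set \<Rightarrow> ('c \<Rightarrow> 'i set) \<Rightarrow> ('c \<Rightarrow> ('i \<Rightarrow> nat set) \<Rightarrow> 'a) \<Rightarrow> 'a topology \<Rightarrow> bool"
  where "parametrizes X C A \<psi> T \<longleftrightarrow> countable C \<and> (\<forall>c\<in>C. finite (A c)) \<and>
    (\<Union>c\<in>C. \<psi> c ` tuples X (A c)) = topspace T \<and>
    (\<forall>c\<in>C. \<forall>x\<in>tuples X (A c). \<forall>W. openin T W \<and> \<psi> c x \<in> W \<longrightarrow>
      (\<exists>h. \<forall>y\<in>tuples X (A c). agree (A c) h x y \<longrightarrow> \<psi> c y \<in> W))"

text \<open>A property in the style of U_fin(O, Omega) for countable covers: a single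
  \<open>g\<close> captures each finite set at one stage, which moreover occurs arbitrarily
  late.\<close>

definition guessable :: "'a topology \<Rightarrow> bool"
  where "guessable T \<longleftrightarrow> (\<forall>U :: nat \<Rightarrow> nat \<Rightarrow> 'a set.
    (\<forall>n i. openin T (U n i)) \<and> (\<forall>n. topspace T \<subseteq> (\<Union>i. U n i)) \<longrightarrow>
    (\<exists>g. \<forall>F N. finite F \<and> F \<subseteq> topspace T \<longrightarrow> (\<exists>n\<ge>N. \<forall>z\<in>F. \<exists>i\<le>g n. z \<in> U n i)))"

lemma guessableD:
  fixes U :: "nat \<Rightarrow> nat \<Rightarrow> 'a set"
  assumes "guessable T" "\<And>n i. openin T (U n i)" "\<And>n. topspace T \<subseteq> (\<Union>i. U n i)"
  shows "\<exists>g. \<forall>F N. finite F \<and> F \<subseteq> topspace T \<longrightarrow> (\<exists>n\<ge>N. \<forall>z\<in>F. \<exists>i\<le>g n. z \<in> U n i)"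
  by (rule assms(1)[unfolded guessable_def, THEN spec, THEN mp]) (simp add: assms)

context small_ideal
begin

text \<open>The finite sets are included so that the truncations of tuples are themselves points to
  which the covers apply.\<close>

definition pts :: "nat set set"
  where "pts = M \<union> Collect finite"

text \<open>Each tuple \<open>q\<close> of subsets of \<open>[0, n)\<close> has a neighbourhood
  inside one \<open>U n K\<close>. There are finitely many such \<open>q\<close>, so
  \<open>h n\<close> can exceed all these \<open>K\<close> and all the agreement lengths defining
  the neighbourhoods.\<close>

lemma gap_bound:
  fixes U :: "nat \<Rightarrow> nat \<Rightarrow> ('i \<Rightarrow> nat set) set"
  assumes A: "finite A"
    and cover: "\<And>x n. x \<in> tuples pts A \<Longrightarrow> \<exists>i. x \<in> U n i"
    and op: "\<And>x n i. x \<in> U n i \<Longrightarrow> x \<in> tuples pts A \<Longrightarrow>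
      \<exists>h. \<forall>y\<in>tuples pts A. agree A h x y \<longrightarrow> y \<in> U n i"
    and mono: "\<And>n i i'. i \<le> i' \<Longrightarrow> U n i \<subseteq> U n i'"
  shows "\<exists>h. mono h \<and> (\<forall>n. n < h n) \<and>
    (\<forall>x\<in>tuples pts A. \<forall>n\<in>gaps (x ` A) h. cover_index U x n \<le> h n)"
proof -
  define Q where "Q n = PiE A (\<lambda>_. Pow {..<n::nat})" for n
  have finQ: "finite (Q n)" for n unfolding Q_def using A by (intro finite_PiE) auto
  have "\<exists>K. \<forall>y\<in>tuples pts A. agree A K q y \<longrightarrow> y \<in> U n K" if "q \<in> Q n" for q n
  proof -
    have "finite (q a)" if "a \<in> A" for a
      using PiE_mem[OF \<open>q \<in> Q n\<close>[unfolded Q_def] that] by (meson PowD finite_lessThan finite_subset)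
    then have q: "q \<in> tuples pts A" by (simp add: tuples_def pts_def)
    then obtain i where i: "q \<in> U n i" using cover by blast
    then obtain h where h: "\<And>y. y \<in> tuples pts A \<Longrightarrow> agree A h q y \<Longrightarrow> y \<in> U n i"
      using op q by metis
    \<comment> \<open>One number serves both as index in the cover and as agreement length.\<close>
    have "y \<in> U n (max i h)" if y: "y \<in> tuples pts A" "agree A (max i h) q y" for y
    proof -
      have "y a \<inter> {..<h} = q a \<inter> {..<h}" if "a \<in> A" for a
      proof -
        have "y a \<inter> {..<max i h} = q a \<inter> {..<max i h}" using y that by blast
        then have "y a \<inter> {..<max i h} \<inter> {..<h} = q a \<inter> {..<max i h} \<inter> {..<h}" by simp
        moreover have "{..<max i h} \<inter> {..<h} = {..<h}" by auto
        ultimately show ?thesis by (simp only: Int_assoc)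
      qed
      then show ?thesis using h y(1) mono[of i "max i h" n] by auto
    qed
    then show ?thesis by blast
  qed
  then have "\<forall>n q. \<exists>K. q \<in> Q n \<longrightarrow> (\<forall>y\<in>tuples pts A. agree A K q y \<longrightarrow> y \<in> U n K)"
    by blast
  then obtain K where
    K: "\<forall>n q. q \<in> Q n \<longrightarrow> (\<forall>y\<in>tuples pts A. agree A (K n q) q y \<longrightarrow> y \<in> U n (K n q))"
    by metis
  \<comment> \<open>The sum bounds every \<open>K n q\<close>, \<open>Suc n\<close> gives
    \<open>n < h n\<close>, and the running maximum gives monotonicity.\<close>
  define h where "h = runmax (\<lambda>n. Suc n + sum (K n) (Q n))"
  have h: "n < h n" "q \<in> Q n \<Longrightarrow> K n q \<le> h n" for n q
  proof -
    have *: "Suc n + sum (K n) (Q n) \<le> h n" unfolding h_def by (rule runmax_ge) simp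
    then show "n < h n" by simp
    show "K n q \<le> h n" if "q \<in> Q n" using member_le_sum[OF that, of "K n"] finQ * by simp
  qed
  have "cover_index U x n \<le> h n" if x: "x \<in> tuples pts A" and n: "n \<in> gaps (x ` A) h" for x n
  proof -
    \<comment> \<open>The truncation of \<open>x\<close> to \<open>[0, n)\<close>. As
      \<open>n\<close> is a gap, \<open>x\<close> agrees with it up to \<open>h n\<close>, hence up
      to \<open>K n q\<close>.\<close>
    define q where "q = (\<lambda>a\<in>A. x a \<inter> {..<n})"
    have q: "q \<in> Q n" by (auto simp: Q_def q_def)
    have "x a \<inter> {..<K n q} = q a \<inter> {..<K n q}" if "a \<in> A" for a
    proof -
      have "m < n" if "m \<in> x a" "m < K n q" for m
        using n that \<open>a \<in> A\<close> h(2)[OF q] unfolding gaps_def by (force simp: not_le)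
      then show ?thesis using \<open>a \<in> A\<close> by (auto simp: q_def)
    qed
    then have "x \<in> U n (K n q)" using K q x by blast
    then show ?thesis using cover_index_le[of x U n "K n q"] h(2)[OF q] by simp
  qed
  then show ?thesis using h(1) mono_runmax unfolding h_def by blast
qed

text \<open>The tuples not covered by \<open>sparse\<close> have a coordinate among fewer than \<open>d\<close> exceptional or finite sets;
  fixing this coordinate reduces the length of the tuple.\<close>

lemma cover_index_image_mem:
  fixes U :: "nat \<Rightarrow> nat \<Rightarrow> ('i \<Rightarrow> nat set) set"
  assumes "finite A"
    and "\<And>x n. x \<in> tuples pts A \<Longrightarrow> \<exists>i. x \<in> U n i"
    and "\<And>x n i. x \<in> U n i \<Longrightarrow> x \<in> tuples pts A \<Longrightarrow>
      \<exists>h. \<forall>y\<in>tuples pts A. agree A h x y \<longrightarrow> y \<in> U n i"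
    and "\<And>n n' i i'. i \<le> i' \<Longrightarrow> n \<le> n' \<Longrightarrow> U n' i \<subseteq> U n i'"
  shows "cover_index U ` tuples pts A \<in> I"
  using assms
proof (induction A arbitrary: U rule: finite_psubset_induct)
  case (psubset A)
  note cover = psubset.prems(1) and op = psubset.prems(2) and mono = psubset.prems(3)
  obtain h where h: "mono h" "\<And>n. n < h n"
    "\<And>x n. x \<in> tuples pts A \<Longrightarrow> n \<in> gaps (x ` A) h \<Longrightarrow> cover_index U x n \<le> h n"
    using gap_bound[of A U, OF psubset.hyps(1) cover op mono[OF _ order_refl]] by blast
  obtain E where E: "small E"
    "\<And>Y. \<forall>f\<in>Y. mono f \<and> (\<exists>S. finite S \<and> S \<subseteq> M - E \<and> (\<forall>n\<in>gaps S h. f n \<le> h n)) \<Longrightarrow> Y \<in> I"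
    using sparse[OF h(1,2)] by blast
  \<comment> \<open>\<open>sparse\<close> speaks of members of \<open>M\<close> outside
    \<open>E\<close> only, so the finite sets count as exceptional values too.\<close>
  define E' where "E' = pts \<inter> (E \<union> Collect finite)"
  define Z where "Z = (\<lambda>(a, e). cover_index U ` {x \<in> tuples pts A. x a = e})"
  define Y where "Y = cover_index U ` tuples (M - E) A"
  have Y: "Y \<in> I"
  proof (rule E(2), intro ballI conjI)
    fix f assume "f \<in> Y"
    then obtain x where x: "f = cover_index U x" "x \<in> tuples (M - E) A" unfolding Y_def by blast
    then have xp: "x \<in> tuples pts A" by (simp add: tuples_def pts_def)
    show "mono f" unfolding x(1) by (rule mono_cover_index) (use cover[OF xp] mono in auto)
    show "\<exists>S. finite S \<and> S \<subseteq> M - E \<and> (\<forall>n\<in>gaps S h. f n \<le> h n)"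
      using x psubset.hyps(1) h(3)[OF xp] by (intro exI[of _ "x ` A"]) (auto simp: tuples_def)
  qed
  have Z: "Z (a, e) \<in> I" if a: "a \<in> A" and e: "e \<in> E'" for a e
  proof -
    \<comment> \<open>The cover on shorter tuples obtained by fixing coordinate \<open>a\<close> to
      \<open>e\<close>. The update overrides the value of \<open>y\<close> at \<open>a\<close>, so
      the index functions of \<open>V\<close> are those of \<open>U\<close> at the completed
      tuples.\<close>
    define V where "V n i = {y. y(a := e) \<in> U n i}" for n i
    have ext: "y(a := e) \<in> tuples pts A" if "y \<in> tuples pts (A - {a})" for y
      using that e by (auto simp: tuples_def E'_def)
    have "cover_index V ` tuples pts (A - {a}) \<in> I"
    proof (rule psubset.IH)
      show "A - {a} \<subset> A" using a by blast
      show "\<exists>i. y \<in> V n i" if "y \<in> tuples pts (A - {a})" for y n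
        using cover[OF ext[OF that]] unfolding V_def mem_Collect_eq .
      show "V n' i \<subseteq> V n i'" if "i \<le> i'" "n \<le> n'" for n n' i i'
        using mono[OF that] unfolding V_def by auto
      show "\<exists>h. \<forall>y\<in>tuples pts (A - {a}). agree (A - {a}) h x y \<longrightarrow> y \<in> V n i"
        if x: "x \<in> V n i" "x \<in> tuples pts (A - {a})" for x n i
      proof -
        obtain h where h: "\<forall>y\<in>tuples pts A. agree A h (x(a := e)) y \<longrightarrow> y \<in> U n i"
          using op[OF x(1)[unfolded V_def mem_Collect_eq] ext[OF x(2)]] by (rule exE)
        have "y \<in> V n i" if "y \<in> tuples pts (A - {a})" "agree (A - {a}) h x y" for y
          unfolding V_def mem_Collect_eq using that
          by (intro h[rule_format] ext) (auto split: if_splits)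
        then show ?thesis by blast
      qed
    qed
    moreover have "cover_index V y = cover_index U (y(a := e))" for y
      unfolding cover_index_def V_def by simp
    moreover have "Z (a, e) = (\<lambda>y. cover_index U (y(a := e))) ` tuples pts (A - {a})"
    proof (intro equalityI subsetI)
      fix f assume "f \<in> Z (a, e)"
      then obtain x where x: "f = cover_index U x" "x \<in> tuples pts A" "x a = e" unfolding Z_def by auto
      then have "x(a := e) = x" "x \<in> tuples pts (A - {a})" by (auto simp: tuples_def)
      then show "f \<in> (\<lambda>y. cover_index U (y(a := e))) ` tuples pts (A - {a})" using x(1) by (metis imageI)
    qed (use ext in \<open>auto simp: Z_def\<close>)
    ultimately show ?thesis by simp
  qed
  have "countable (Collect finite :: nat set set)" by (rule countable_Collect_finite)
  then have "small E'" unfolding E'_def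
    by (intro small_mono[OF Int_lower2] small_Un E(1) countable_imp_small)
  then have "small ({Y} \<union> Z ` (A \<times> E'))"
    using psubset.hyps(1)
    by (intro small_Un small_image small_Times) (auto intro: countable_imp_small countable_finite)
  then have "small (insert Y (Z ` (A \<times> E')))" by simp
  moreover have "insert Y (Z ` (A \<times> E')) \<subseteq> I" using Y Z by auto
  ultimately have "\<Union>(insert Y (Z ` (A \<times> E'))) \<in> I" by (rule Union_closed)
  moreover have "\<Union>(insert Y (Z ` (A \<times> E'))) = cover_index U ` tuples pts A"
  proof (intro equalityI subsetI)
    fix f assume "f \<in> cover_index U ` tuples pts A"
    then obtain x where x: "f = cover_index U x" "x \<in> tuples pts A" by blast
    show "f \<in> \<Union>(insert Y (Z ` (A \<times> E')))"
    proof (cases "x \<in> tuples (M - E) A")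
      case False
      then obtain a where "a \<in> A" "x a \<in> E'"
        using x(2) unfolding tuples_def E'_def pts_def by blast
      moreover have "f \<in> Z (a, x a)" using x unfolding Z_def by blast
      ultimately show ?thesis by blast
    qed (use x in \<open>simp add: Y_def\<close>)
  next
    fix f assume "f \<in> \<Union>(insert Y (Z ` (A \<times> E')))"
    moreover have "tuples (M - E) A \<subseteq> tuples pts A" by (auto simp: tuples_def pts_def)
    ultimately show "f \<in> cover_index U ` tuples pts A" unfolding Y_def Z_def by auto
  qed
  ultimately show ?case by simp
qed

text \<open>The index functions of points parametrized by one \<open>c\<close> form a member of
  \<open>I\<close>, and countably many values of \<open>c\<close> are absorbed by
  \<open>Union_closed\<close>. Then \<open>guess\<close> provides \<open>g\<close>.\<close>

lemma parametrizes_imp_guessable: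
  fixes T :: "'t topology"
  assumes par: "parametrizes pts C A \<psi> T"
  shows "guessable T"
  unfolding guessable_def
proof (intro allI impI, elim conjE)
  fix U :: "nat \<Rightarrow> nat \<Rightarrow> 't set"
  assume U: "\<forall>n i. openin T (U n i)" "\<forall>n. topspace T \<subseteq> (\<Union>i. U n i)"
  \<comment> \<open>Open covers that increase in \<open>i\<close> and decrease in \<open>n\<close>;
    the latter makes the index functions monotone. Taking \<open>m = n\<close> in the intersection
    leads back to \<open>U\<close>.\<close>
  define V where "V n i = (\<Inter>m\<in>{..n}. \<Union>j\<in>{..i}. U m j)" for n i
  have V_open: "openin T (V n i)" for n i
    unfolding V_def using U(1) by (intro openin_INT2 openin_Union) auto
  have V_cover: "\<exists>i. z \<in> V n i" if "z \<in> topspace T" for z n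
  proof -
    have "\<forall>m. \<exists>i. z \<in> U m i" using that U(2) by blast
    then obtain i where i: "\<And>m. z \<in> U m (i m)" by metis
    have "z \<in> V n (Max (i ` {..n}))"
      unfolding V_def using i by (auto intro!: bexI[of _ "i _"] Max_ge)
    then show ?thesis by blast
  qed
  have V_mono: "V n' i \<subseteq> V n i'" if "i \<le> i'" "n \<le> n'" for n n' i i'
    unfolding V_def using that by fastforce
  have par': "countable C" "topspace T = (\<Union>c\<in>C. \<psi> c ` tuples pts (A c))"
    using par unfolding parametrizes_def by auto
  define Y where "Y c = cover_index (\<lambda>n i. {x. \<psi> c x \<in> V n i}) ` tuples pts (A c)" for c
  have Y: "Y c \<in> I" if c: "c \<in> C" for c
    unfolding Y_def
  proof (rule cover_index_image_mem)
    show "finite (A c)" using par c by (simp add: parametrizes_def)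
    show "\<exists>i. x \<in> {x. \<psi> c x \<in> V n i}" if "x \<in> tuples pts (A c)" for x n
    proof -
      have "\<psi> c x \<in> topspace T" unfolding par'(2) using that c by blast
      then show ?thesis using V_cover by simp
    qed
    show "\<exists>h. \<forall>y\<in>tuples pts (A c). agree (A c) h x y \<longrightarrow> y \<in> {x. \<psi> c x \<in> V n i}"
      if "x \<in> {x. \<psi> c x \<in> V n i}" "x \<in> tuples pts (A c)" for x n i
      using par c that V_open[of n i] unfolding parametrizes_def by simp
    show "{x. \<psi> c x \<in> V n' i} \<subseteq> {x. \<psi> c x \<in> V n i'}" if "i \<le> i'" "n \<le> n'" for n n' i i'
      using V_mono[OF that] by blast
  qed
  have "\<Union>(Y ` C) \<in> I"
    using Y par'(1) by (intro Union_closed countable_imp_small) auto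
  moreover have "\<Union>(Y ` C) = cover_index V ` topspace T"
  proof -
    have "cover_index (\<lambda>n i. {x. \<psi> c x \<in> V n i}) x = cover_index V (\<psi> c x)" for c x
      unfolding cover_index_def by simp
    then show ?thesis unfolding Y_def par'(2) by (simp add: image_UN image_image)
  qed
  ultimately have "cover_index V ` topspace T \<in> I" by simp
  from guess[OF this] obtain g where
    g: "\<forall>F N. finite F \<and> F \<subseteq> cover_index V ` topspace T \<longrightarrow> (\<exists>n\<ge>N. \<forall>f\<in>F. f n \<le> g n)" by (rule exE)
  have "\<exists>n\<ge>N. \<forall>z\<in>F. \<exists>i\<le>g n. z \<in> U n i" if F: "finite F" "F \<subseteq> topspace T" for F N
  proof -
    have "finite (cover_index V ` F)" "cover_index V ` F \<subseteq> cover_index V ` topspace T" using F by auto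
    then obtain n where n: "n \<ge> N" "\<And>z. z \<in> F \<Longrightarrow> cover_index V z n \<le> g n" using g by (metis imageI)
    have "\<exists>i\<le>g n. z \<in> U n i" if "z \<in> F" for z
    proof -
      have "z \<in> V n (cover_index V z n)" using V_cover F that by (intro cover_index_mem) auto
      then obtain i where "i \<le> cover_index V z n" "z \<in> U n i" unfolding V_def by auto
      then show ?thesis using n(2)[OF that] order_trans by blast
    qed
    then show ?thesis using n(1) by blast
  qed
  then show "\<exists>g. \<forall>F N. finite F \<and> F \<subseteq> topspace T \<longrightarrow> (\<exists>n\<ge>N. \<forall>z\<in>F. \<exists>i\<le>g n. z \<in> U n i)"
    by (intro exI[of _ g]) blast
qed

end

text \<open>A point of the power takes one parameter for each factor, and the tuples of the factors
  combine into a single tuple over the disjoint union of their index sets. So finite powers need no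
  separate argument.\<close>

lemma parametrizes_power:
  assumes par: "parametrizes X C A \<psi> T" and J: "finite J"
  shows "parametrizes X (PiE J (\<lambda>_. C)) (\<lambda>c. SIGMA l:J. A (c l))
    (\<lambda>c x. \<lambda>l\<in>J. \<psi> (c l) (\<lambda>a. x (l, a))) (product_topology (\<lambda>_. T) J)"
proof -
  have top: "topspace T = (\<Union>c\<in>C. \<psi> c ` tuples X (A c))"
    using par unfolding parametrizes_def by auto
  have tup: "(\<lambda>a. x (l, a)) \<in> tuples X (A (c l))"
    if "x \<in> tuples X (SIGMA l:J. A (c l))" "l \<in> J" for x l c
    using that by (auto simp: tuples_def)
  have 1: "(\<lambda>l\<in>J. \<psi> (c l) (\<lambda>a. x (l, a))) \<in> PiE J (\<lambda>_. topspace T)"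
    if "c \<in> PiE J (\<lambda>_. C)" "x \<in> tuples X (SIGMA l:J. A (c l))" for c x
    unfolding top using tup[OF that(2)] that(1) by (fastforce simp: PiE_iff)
  have 2: "\<exists>c\<in>PiE J (\<lambda>_. C). z \<in> (\<lambda>x. \<lambda>l\<in>J. \<psi> (c l) (\<lambda>a. x (l, a))) ` tuples X (SIGMA l:J. A (c l))"
    if z: "z \<in> PiE J (\<lambda>_. topspace T)" for z
  proof -
    have "\<forall>l\<in>J. \<exists>c x. c \<in> C \<and> x \<in> tuples X (A c) \<and> z l = \<psi> c x"
      using z unfolding top by (fastforce simp: PiE_iff)
    then obtain c x where cx: "\<And>l. l \<in> J \<Longrightarrow> c l \<in> C \<and> x l \<in> tuples X (A (c l)) \<and> z l = \<psi> (c l) (x l)"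
      by metis
    have "z = (\<lambda>l\<in>J. \<psi> (restrict c J l) (\<lambda>a. case_prod x (l, a)))"
    proof
      fix l show "z l = (\<lambda>l\<in>J. \<psi> (restrict c J l) (\<lambda>a. case_prod x (l, a))) l"
        using cx[of l] z by (cases "l \<in> J") (auto simp: PiE_iff extensional_def)
    qed
    moreover have "case_prod x \<in> tuples X (SIGMA l:J. A (restrict c J l))"
      using cx by (auto simp: tuples_def)
    moreover have "restrict c J \<in> PiE J (\<lambda>_. C)" using cx by auto
    ultimately show ?thesis by blast
  qed
  have 3: "\<exists>h. \<forall>y\<in>tuples X (SIGMA l:J. A (c l)). agree (SIGMA l:J. A (c l)) h x y \<longrightarrow>
      (\<lambda>l\<in>J. \<psi> (c l) (\<lambda>a. y (l, a))) \<in> W"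
    if c: "c \<in> PiE J (\<lambda>_. C)" and x: "x \<in> tuples X (SIGMA l:J. A (c l))"
      and W: "openin (product_topology (\<lambda>_. T) J) W" "(\<lambda>l\<in>J. \<psi> (c l) (\<lambda>a. x (l, a))) \<in> W" for c x W
  proof -
    obtain U where U: "\<And>l. l \<in> J \<Longrightarrow> openin T (U l)"
      "(\<lambda>l\<in>J. \<psi> (c l) (\<lambda>a. x (l, a))) \<in> PiE J U" "PiE J U \<subseteq> W"
      using W(1)[unfolded openin_product_topology_alt, THEN bspec, OF W(2)] by (elim exE conjE) auto
    have "\<forall>l\<in>J. \<exists>h. \<forall>y\<in>tuples X (A (c l)). agree (A (c l)) h (\<lambda>a. x (l, a)) y \<longrightarrow> \<psi> (c l) y \<in> U l"
    proof
      fix l assume l: "l \<in> J"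
      then have "c l \<in> C" "\<psi> (c l) (\<lambda>a. x (l, a)) \<in> U l" using c U(2) by (auto simp: PiE_iff)
      then show "\<exists>h. \<forall>y\<in>tuples X (A (c l)). agree (A (c l)) h (\<lambda>a. x (l, a)) y \<longrightarrow> \<psi> (c l) y \<in> U l"
        using par tup[OF x l] U(1)[OF l] unfolding parametrizes_def by simp
    qed
    then obtain h where h: "\<And>l y. l \<in> J \<Longrightarrow> y \<in> tuples X (A (c l)) \<Longrightarrow>
        agree (A (c l)) (h l) (\<lambda>a. x (l, a)) y \<Longrightarrow> \<psi> (c l) y \<in> U l"
      by (metis (no_types, lifting))
    define H where "H = sum h J"
    have "(\<lambda>l\<in>J. \<psi> (c l) (\<lambda>a. y (l, a))) \<in> W"
      if y: "y \<in> tuples X (SIGMA l:J. A (c l))" "agree (SIGMA l:J. A (c l)) H x y" for y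
    proof -
      have "\<psi> (c l) (\<lambda>a. y (l, a)) \<in> U l" if l: "l \<in> J" for l
      proof (rule h[OF l tup[OF y(1) l]], intro ballI)
        fix a assume "a \<in> A (c l)"
        then have *: "y (l, a) \<inter> {..<H} = x (l, a) \<inter> {..<H}" using y(2) l by blast
        have "h l \<le> H" unfolding H_def using J l by (intro member_le_sum) auto
        then have "{..<h l} = {..<H} \<inter> {..<h l}" by auto
        then show "y (l, a) \<inter> {..<h l} = x (l, a) \<inter> {..<h l}" using * by (metis Int_assoc)
      qed
      then show ?thesis using U(3) by auto
    qed
    then show ?thesis by blast
  qed
  have "countable (PiE J (\<lambda>_. C))" "\<And>c. c \<in> PiE J (\<lambda>_. C) \<Longrightarrow> finite (SIGMA l:J. A (c l))"
    using par J unfolding parametrizes_def by (auto intro!: countable_PiE)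
  moreover have "(\<Union>c\<in>PiE J (\<lambda>_. C). (\<lambda>x. \<lambda>l\<in>J. \<psi> (c l) (\<lambda>a. x (l, a))) ` tuples X (SIGMA l:J. A (c l)))
      = topspace (product_topology (\<lambda>_. T) J)"
    unfolding topspace_product_topology using 1 2 by (intro equalityI subsetI) (blast, simp)
  ultimately show ?thesis
    unfolding parametrizes_def
    by (intro conjI ballI allI impI) (blast, blast, blast, elim conjE, rule 3)
qed

text \<open>The \<open>k\<close>-th powers of the members of an \<omega>-cover cover the
  \<open>k\<close>-th power of the space, so guessability of the power captures any \<open>k\<close>
  points by one member. A diagonal bound treats all \<open>k\<close> together.\<close>

lemma S_fin_Omega_covers:
  assumes gu: "\<And>k::nat. k \<ge> 1 \<Longrightarrow> guessable (product_topology (\<lambda>_. T) {1..k})"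
  shows "S_fin (Omega_covers T) (Omega_covers T)"
  unfolding S_fin_def
proof (intro allI impI)
  fix u :: "nat \<Rightarrow> 'a set set" assume "\<forall>n. u n \<in> Omega_covers T"
  then have u: "countable (u n)" "\<And>U. U \<in> u n \<Longrightarrow> openin T U" "topspace T \<notin> u n"
    "\<And>F. finite F \<Longrightarrow> F \<subseteq> topspace T \<Longrightarrow> \<exists>U\<in>u n. F \<subseteq> U" for n
    unfolding Omega_covers_def omega_cover_def by auto
  have ne: "u n \<noteq> {}" for n using u(4)[of "{}"] by auto
  define W where "W n = from_nat_into (u n)" for n
  have W: "range (W n) = u n" for n unfolding W_def using u(1) ne by simp
  then have W_open: "openin T (W n i)" for n i using u(2) by blast
  have "\<exists>g. \<forall>z\<in>PiE {1..k} (\<lambda>_. topspace T). \<forall>N. \<exists>n\<ge>N. \<exists>i\<le>g n. z ` {1..k} \<subseteq> W n i"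
    if k: "k \<ge> 1" for k :: nat
  proof -
    define U where "U n i = PiE {1..k} (\<lambda>_. W n i)" for n i
    let ?T = "product_topology (\<lambda>_. T) {1..k}"
    have U: "openin ?T (U n i)" for n i unfolding U_def by (simp add: openin_PiE W_open)
    have "topspace ?T \<subseteq> (\<Union>i. U n i)" for n
    proof
      fix z assume "z \<in> topspace ?T"
      then have z: "z \<in> PiE {1..k} (\<lambda>_. topspace T)" by simp
      then have "finite (z ` {1..k})" "z ` {1..k} \<subseteq> topspace T" by auto
      then obtain V where "V \<in> u n" "z ` {1..k} \<subseteq> V" using u(4) by metis
      then obtain i where "z ` {1..k} \<subseteq> W n i" using W by (metis imageE)
      then have "z \<in> U n i" using z unfolding U_def by (simp add: PiE_iff image_subset_iff)
      then show "z \<in> (\<Union>i. U n i)" by blast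
    qed
    from guessableD[OF gu[OF k] U this] obtain g where
      g: "\<forall>F N. finite F \<and> F \<subseteq> topspace ?T \<longrightarrow> (\<exists>n\<ge>N. \<forall>z\<in>F. \<exists>i\<le>g n. z \<in> U n i)"
      by (rule exE)
    have "\<exists>n\<ge>N. \<exists>i\<le>g n. z ` {1..k} \<subseteq> W n i" if "z \<in> PiE {1..k} (\<lambda>_. topspace T)" for z N
    proof -
      have "finite {z} \<and> {z} \<subseteq> topspace ?T" using that by simp
      from g[rule_format, OF this, of N] obtain n i where "n \<ge> N" "i \<le> g n" "z \<in> U n i" by auto
      moreover then have "z ` {1..k} \<subseteq> W n i" unfolding U_def by auto
      ultimately show ?thesis by blast
    qed
    then show ?thesis by (intro exI[of _ g]) simp
  qed
  then obtain g where g: "\<And>k z N. k \<ge> 1 \<Longrightarrow> z \<in> PiE {1..k} (\<lambda>_. topspace T) \<Longrightarrow>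
      \<exists>n\<ge>N. \<exists>i\<le>g k n. z ` {1..k::nat} \<subseteq> W n i"
    by metis
  \<comment> \<open>The diagonal bound dominates \<open>g k\<close> from \<open>k\<close> on. It
    suffices because the stage \<open>n\<close> can be chosen with \<open>n \<ge> k\<close>.\<close>
  define G where "G n = Max ((\<lambda>k. g k n) ` {..n})" for n
  define v where "v n = W n ` {..G n}" for n
  have v: "finite (v n)" "v n \<subseteq> u n" for n using W unfolding v_def by auto
  have fin: "\<exists>U\<in>\<Union>(range v). F \<subseteq> U" if F: "finite F" "F \<subseteq> topspace T" for F
  proof -
    \<comment> \<open>A member of the cover is a proper subset, so the space has a point
      \<open>p\<close>. Adding it to \<open>F\<close> ensures \<open>k \<ge> 1\<close> when
      \<open>F\<close> is empty.\<close>
    obtain V where "V \<in> u 0" using ne by blast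
    then have "V \<subseteq> topspace T" "V \<noteq> topspace T" using u(2,3) openin_subset[of T V] by metis+
    then obtain p where p: "p \<in> topspace T" by blast
    define k where "k = card (insert p F)"
    obtain e where e: "bij_betw e {1..k} (insert p F)"
      using ex_bij_betw_nat_finite_1[of "insert p F"] F unfolding k_def by auto
    have "restrict e {1..k} \<in> PiE {1..k} (\<lambda>_. topspace T)"
      using e F p by (auto simp: bij_betw_def)
    moreover have "k \<ge> 1" using F by (simp add: k_def Suc_le_eq card_gt_0_iff)
    ultimately obtain n i where n: "n \<ge> k" "i \<le> g k n" "restrict e {1..k} ` {1..k} \<subseteq> W n i"
      using g by blast
    have "restrict e {1..k} ` {1..k} = insert p F" using e by (simp add: bij_betw_def)
    moreover have "g k n \<le> G n" unfolding G_def using n by (intro Max_ge) auto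
    ultimately have "W n i \<in> v n" "F \<subseteq> W n i" using n unfolding v_def by auto
    then show ?thesis by blast
  qed
  have "\<Union>(range v) \<in> Omega_covers T"
  proof -
    have "countable (\<Union>(range v))" using v(1) by (intro countable_UN) (auto simp: countable_finite)
    moreover have op: "\<forall>U\<in>\<Union>(range v). openin T U" using v(2) u(2) by blast
    moreover have "topspace T \<notin> \<Union>(range v)" using v(2) u(3) by blast
    moreover have "\<Union>(\<Union>(range v)) = topspace T"
    proof
      show "\<Union>(\<Union>(range v)) \<subseteq> topspace T" using op openin_subset by blast
      show "topspace T \<subseteq> \<Union>(\<Union>(range v))"
      proof
        fix z assume "z \<in> topspace T"
        then show "z \<in> \<Union>(\<Union>(range v))" using fin[of "{z}"] by simp
      qed
    qed
    ultimately show ?thesis unfolding Omega_covers_def omega_cover_def using fin by auto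
  qed
  with v show "\<exists>v. (\<forall>n. finite (v n) \<and> v n \<subseteq> u n) \<and> (\<Union>n. v n) \<in> Omega_covers T" by blast
qed

text \<open>A translate of \<open>U\<close> is the preimage of \<open>U\<close> under translation by
  the inverse, hence open; so guessability applies to the covers by translates.\<close>

lemma translate_selection_guessable:
  fixes G :: "('a, 'b) monoid_scheme" (structure)
  assumes "group G" and top: "carrier G = topspace T" and gu: "guessable T"
    and cont: "\<And>g. g \<in> carrier G \<Longrightarrow> continuous_map T T (\<lambda>z. g \<otimes> z)"
  shows "translate_selection G T"
  unfolding translate_selection_def
proof (intro allI impI)
  interpret group G by fact
  fix U :: "nat \<Rightarrow> 'a set" and g :: "nat \<Rightarrow> nat \<Rightarrow> 'a"
  assume "\<forall>m\<ge>1. openin T (U m) \<and> (\<forall>n\<ge>1. g m n \<in> carrier G) \<and>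
    (\<Union>n\<in>{1..}. g m n <#\<^bsub>G\<^esub> U m) = carrier G"
  then have U: "openin T (U (Suc m))" "g (Suc m) (Suc n) \<in> carrier G"
    "carrier G = (\<Union>n\<in>{1..}. g (Suc m) n <#\<^bsub>G\<^esub> U (Suc m))" for m n :: nat
    by auto
  have coset: "g (Suc m) (Suc n) <#\<^bsub>G\<^esub> U (Suc m) =
      {z \<in> topspace T. inv (g (Suc m) (Suc n)) \<otimes> z \<in> U (Suc m)}" for m n
  proof -
    have sub: "U (Suc m) \<subseteq> carrier G" using U(1) openin_subset top by metis
    show ?thesis
    proof (intro equalityI subsetI)
      fix z assume "z \<in> g (Suc m) (Suc n) <#\<^bsub>G\<^esub> U (Suc m)"
      then obtain y where "y \<in> U (Suc m)" "z = g (Suc m) (Suc n) \<otimes> y" unfolding l_coset_def by auto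
      moreover then have "y \<in> carrier G" using sub by blast
      ultimately show "z \<in> {z \<in> topspace T. inv (g (Suc m) (Suc n)) \<otimes> z \<in> U (Suc m)}"
        using U(2)[of m n] by (simp add: top[symmetric] m_assoc[symmetric])
    next
      fix z assume "z \<in> {z \<in> topspace T. inv (g (Suc m) (Suc n)) \<otimes> z \<in> U (Suc m)}"
      then have "z \<in> carrier G" "inv (g (Suc m) (Suc n)) \<otimes> z \<in> U (Suc m)" using top by auto
      moreover then have "z = g (Suc m) (Suc n) \<otimes> (inv (g (Suc m) (Suc n)) \<otimes> z)"
        using U(2)[of m n] by (simp add: m_assoc[symmetric])
      ultimately show "z \<in> g (Suc m) (Suc n) <#\<^bsub>G\<^esub> U (Suc m)" unfolding l_coset_def by blast
    qed
  qed
  \<comment> \<open>shifts from indices starting at 1 to indices starting at 0\<close>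
  define V where "V m n = g (Suc m) (Suc n) <#\<^bsub>G\<^esub> U (Suc m)" for m n
  have V_open: "openin T (V m n)" for m n
    unfolding V_def coset
    using openin_continuous_map_preimage[OF cont[OF inv_closed[OF U(2)]] U(1)] by simp
  have V_cover: "topspace T \<subseteq> (\<Union>n. V m n)" for m
  proof
    fix z assume "z \<in> topspace T"
    then obtain n where n: "n \<ge> 1" "z \<in> g (Suc m) n <#\<^bsub>G\<^esub> U (Suc m)" using U(3)[of m] top by auto
    then have "z \<in> V m (n - 1)" unfolding V_def by simp
    then show "z \<in> (\<Union>n. V m n)" by blast
  qed
  from guessableD[OF gu V_open V_cover] obtain b where
    b: "\<forall>F N. finite F \<and> F \<subseteq> topspace T \<longrightarrow> (\<exists>n\<ge>N. \<forall>z\<in>F. \<exists>i\<le>b n. z \<in> V n i)"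
    by (rule exE)
  have "\<exists>n\<ge>1. F \<subseteq> (g n ` {1..Suc (b (n - 1))}) <#>\<^bsub>G\<^esub> U n" if F: "finite F" "F \<subseteq> carrier G" for F
  proof -
    have "finite F \<and> F \<subseteq> topspace T" using F top by simp
    from b[rule_format, OF this, of 0] obtain n where n: "\<And>z. z \<in> F \<Longrightarrow> \<exists>i\<le>b n. z \<in> V n i" by auto
    have "z \<in> (g (Suc n) ` {1..Suc (b n)}) <#>\<^bsub>G\<^esub> U (Suc n)" if "z \<in> F" for z
    proof -
      obtain i where i: "i \<le> b n" "z \<in> g (Suc n) (Suc i) <#\<^bsub>G\<^esub> U (Suc n)"
        using n[OF \<open>z \<in> F\<close>] unfolding V_def by blast
      then have "g (Suc n) (Suc i) \<in> g (Suc n) ` {1..Suc (b n)}" by auto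
      then show ?thesis using i(2) unfolding set_mult_def l_coset_def by blast
    qed
    then show ?thesis by (intro exI[of _ "Suc n"]) auto
  qed
  then show "\<exists>M. \<forall>F. finite F \<and> F \<subseteq> carrier G \<longrightarrow> (\<exists>n\<ge>1. F \<subseteq> (g n ` {1..M n}) <#>\<^bsub>G\<^esub> U n)"
    by (intro exI[of _ "\<lambda>n. Suc (b (n - 1))"]) blast
qed

lemma continuous_map_product_translation:
  assumes cont: "\<And>g. g \<in> carrier G \<Longrightarrow> continuous_map T T (\<lambda>z. g \<otimes>\<^bsub>G\<^esub> z)"
    and g: "g \<in> PiE J (\<lambda>_. carrier G)"
  shows "continuous_map (product_topology (\<lambda>_. T) J) (product_topology (\<lambda>_. T) J)
    (\<lambda>z. g \<otimes>\<^bsub>product_group J (\<lambda>_. G)\<^esub> z)"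
  unfolding continuous_map_componentwise
proof (intro conjI ballI)
  fix l assume l: "l \<in> J"
  have "continuous_map (product_topology (\<lambda>_. T) J) T ((\<lambda>z. g l \<otimes>\<^bsub>G\<^esub> z) \<circ> (\<lambda>z. z l))"
    using g l by (intro continuous_map_compose[OF _ cont] continuous_map_product_projection) auto
  then show "continuous_map (product_topology (\<lambda>_. T) J) T (\<lambda>z. (g \<otimes>\<^bsub>product_group J (\<lambda>_. G)\<^esub> z) l)"
    using l by (simp add: o_def)
qed auto

section \<open>Rational spans of ternary reals\<close>

definition ternary :: "nat set \<Rightarrow> real"
  where "ternary x = (\<Sum>n. of_bool (n \<in> x) * (1/3) ^ n)"

lemma summable_ternary: "summable (\<lambda>n. of_bool (n \<in> x) * (1/3::real) ^ n)"
  by (rule summable_comparison_test'[OF summable_geometric[of "1/3::real"], of 0]) auto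

text \<open>The bound is the sum of the geometric tail from \<open>h\<close> on. It serves both
  continuity of the parametrization and injectivity of the code.\<close>

lemma ternary_agree:
  assumes "x \<inter> {..<h} = y \<inter> {..<h}"
  shows "\<bar>ternary x - ternary y\<bar> \<le> 3/2 * (1/3) ^ h"
proof -
  define d :: "nat \<Rightarrow> real" where "d n = (of_bool (n \<in> x) - of_bool (n \<in> y)) * (1/3) ^ n" for n
  have d0: "d n = 0" if "n < h" for n using assms that unfolding d_def by auto
  have d: "d = (\<lambda>n. of_bool (n \<in> x) * (1/3) ^ n - of_bool (n \<in> y) * (1/3) ^ n)"
    by (auto simp: d_def algebra_simps)
  have sm: "summable d" unfolding d by (intro summable_diff summable_ternary)
  have geo: "summable (\<lambda>n. (1/3::real) ^ h * (1/3) ^ n)"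
    by (intro summable_mult summable_geometric) simp
  have le: "\<bar>d (n + h)\<bar> \<le> (1/3) ^ h * (1/3) ^ n" for n
    unfolding d_def by (auto simp: abs_mult power_add)
  have abs: "summable (\<lambda>n. \<bar>d (n + h)\<bar>)"
    by (rule summable_comparison_test'[OF geo, of 0]) (use le in simp)
  have "ternary x - ternary y = suminf d"
    unfolding ternary_def d by (intro suminf_diff summable_ternary)
  also have "\<dots> = (\<Sum>n. d (n + h))"
    using suminf_split_initial_segment[OF sm, of h] d0 by simp
  finally have "\<bar>ternary x - ternary y\<bar> = \<bar>\<Sum>n. d (n + h)\<bar>" by simp
  also have "\<dots> \<le> (\<Sum>n. \<bar>d (n + h)\<bar>)" using summable_rabs[OF abs] .
  also have "\<dots> \<le> (\<Sum>n. (1/3) ^ h * (1/3) ^ n)" by (intro suminf_le le abs geo)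
  also have "\<dots> = 3/2 * (1/3) ^ h"
    by (subst suminf_mult) (simp_all add: suminf_geometric summable_geometric)
  finally show ?thesis .
qed

lemma ternary_insert:
  assumes "n \<notin> x"
  shows "ternary (insert n x) = ternary x + (1/3) ^ n"
proof -
  have "(\<lambda>m. of_bool (m \<in> x) * (1/3) ^ m + (if m = n then (1/3) ^ m else 0)) sums (ternary x + (1/3) ^ n)"
    unfolding ternary_def
    by (intro sums_add summable_sums summable_ternary sums_single)
  also have "(\<lambda>m. of_bool (m \<in> x) * (1/3) ^ m + (if m = n then (1/3) ^ m else 0)) =
      (\<lambda>m. of_bool (m \<in> insert n x) * (1/3::real) ^ m)"
    using assms by auto
  finally show ?thesis unfolding ternary_def by (simp add: sums_iff)
qed

lemma inj_ternary: "inj ternary"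
proof -
  have neq: "ternary x \<noteq> ternary y"
    if "n \<in> x" "n \<notin> y" "x \<inter> {..<n} = y \<inter> {..<n}" for x y and n :: nat
  proof -
    \<comment> \<open>the base is 3, so that the tail after \<open>n\<close> is at most half of the \<open>n\<close>-th term\<close>
    have "x \<inter> {..<Suc n} = insert n y \<inter> {..<Suc n}" using that by (auto simp: lessThan_Suc)
    from ternary_agree[OF this] have "\<bar>ternary x - (ternary y + (1/3) ^ n)\<bar> \<le> (1/3) ^ n / 2"
      using ternary_insert[OF that(2)] by simp
    moreover have "(0::real) < (1/3) ^ n" by simp
    ultimately show ?thesis by linarith
  qed
  show ?thesis
  proof (rule injI, rule ccontr)
    fix x y :: "nat set" assume eq: "ternary x = ternary y" "x \<noteq> y"
    define n where "n = (LEAST n. (n \<in> x) \<noteq> (n \<in> y))"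
    have ex: "\<exists>n. (n \<in> x) \<noteq> (n \<in> y)" using eq(2) by blast
    from LeastI_ex[OF this] have n: "(n \<in> x) \<noteq> (n \<in> y)" unfolding n_def .
    have "x \<inter> {..<n} = y \<inter> {..<n}" using not_less_Least unfolding n_def by blast
    then show False using n neq[of n x y] neq[of n y x] eq(1) by auto
  qed
qed

lemma ternary_finite:
  assumes "finite x"
  shows "ternary x \<in> \<rat>"
  using assms
proof induction
  case (insert n x)
  then show ?case by (simp add: ternary_insert)
qed (simp add: ternary_def)

interpretation Q: vector_space "\<lambda>(q::rat) (x::real). of_rat q * x"
  by unfold_locales (auto simp: algebra_simps of_rat_add of_rat_mult)

text \<open>The generator 1 brings in all rationals, in particular the codes of the finite
  sets.\<close>

definition gen :: "nat set set \<Rightarrow> real set"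
  where "gen S = Q.span (insert 1 (ternary ` S))"

lemma ternary_mem_gen:
  assumes "x \<in> S \<union> Collect finite"
  shows "ternary x \<in> gen S"
proof (cases "x \<in> S")
  case False
  then obtain q where q: "ternary x = of_rat q" using assms ternary_finite by (auto elim: Rats_cases)
  have "of_rat q * 1 \<in> gen S" unfolding gen_def by (intro Q.span_scale Q.span_base) simp
  with q show ?thesis by simp
qed (auto simp: gen_def intro: Q.span_base)

lemma gen_combination:
  assumes "z \<in> gen S"
  shows "\<exists>ps\<in>lists (UNIV \<times> (S \<union> Collect finite)).
    z = (\<Sum>i<length ps. of_rat (fst (ps ! i)) * ternary (snd (ps ! i)))"
  using assms unfolding gen_def
proof (induction rule: Q.span_induct_alt)
  case base
  show ?case by (intro bexI[of _ "[]"]) auto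
next
  case (step c b y)
  then obtain ps where ps: "ps \<in> lists (UNIV \<times> (S \<union> Collect finite))"
    "y = (\<Sum>i<length ps. of_rat (fst (ps ! i)) * ternary (snd (ps ! i)))" by blast
  \<comment> \<open>The generator 1 is thus itself the code of a finite set, and every generator is
    a code.\<close>
  have "ternary {0} = 1" using ternary_insert[of 0 "{}"] by (simp add: ternary_def)
  then obtain u where u: "u \<in> S \<union> Collect finite" "b = ternary u"
    using step.hyps(1) by (metis UnI1 UnI2 finite.emptyI finite.insertI image_iff insert_iff mem_Collect_eq)
  have "of_rat c * b + y = (\<Sum>i<length ((c, u) # ps).
      of_rat (fst (((c, u) # ps) ! i)) * ternary (snd (((c, u) # ps) ! i)))"
    unfolding ps(2) u(2) length_Cons sum.lessThan_Suc_shift by simp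
  moreover have "(c, u) # ps \<in> lists (UNIV \<times> (S \<union> Collect finite))" using ps(1) u(1) by simp
  ultimately show ?case by blast
qed

lemma card_of_gen:
  assumes "infinite S"
  shows "|gen S| =o |S|"
proof -
  have cS: "|A| \<le>o |S|" if "countable A" for A :: "'c set"
  proof -
    have "|A| \<le>o |UNIV :: nat set|" using that unfolding countable_def by (metis card_of_ordLeq subset_UNIV)
    also have "|UNIV :: nat set| \<le>o |S|" using assms infinite_iff_card_of_nat by metis
    finally show ?thesis .
  qed
  have inf: "infinite (Field |S| )" using assms by (simp only: Field_card_of) simp
  define B where "B = (UNIV :: rat set) \<times> (S \<union> Collect finite)"
  have Un: "|S \<union> Collect finite| \<le>o |S|"
    by (intro card_of_Un_ordLeq_infinite_Field[OF inf] card_of_Card_order cS countable_Collect_finite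
        ordIso_imp_ordLeq[OF card_of_refl])
  have B: "|B| \<le>o |S|" unfolding B_def
    by (rule card_of_Times_ordLeq_infinite_Field[OF inf cS Un card_of_Card_order]) simp
  have "infinite B" using assms unfolding B_def by (auto dest: finite_cartesian_productD2)
  have "gen S \<subseteq> (\<lambda>ps. \<Sum>i<length ps. of_rat (fst (ps ! i)) * ternary (snd (ps ! i))) ` lists B"
    using gen_combination unfolding B_def by blast
  then have "|gen S| \<le>o |lists B|"
    by (rule ordLeq_transitive[OF card_of_mono1 card_of_image])
  also have "|lists B| \<le>o |B|" by (rule card_of_lists_le) fact
  also note B
  finally have le: "|gen S| \<le>o |S|" .
  have "inj_on ternary S" "ternary ` S \<subseteq> gen S"
    using inj_ternary ternary_mem_gen by (auto intro: inj_on_subset)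
  then have "|S| \<le>o |gen S|" using card_of_ordLeq by metis
  with le show ?thesis by (simp add: ordIso_iff_ordLeq)
qed

text \<open>The parameter is the list of rational coefficients. For fixed coefficients, agreement of
  the tuples up to \<open>h\<close> moves the sum by at most a constant times
  \<open>(1/3) ^ h\<close>.\<close>

lemma parametrizes_gen:
  "parametrizes (S \<union> Collect finite) UNIV (\<lambda>c. {..<length c})
    (\<lambda>c x. \<Sum>i<length c. of_rat (c ! i) * ternary (x i)) (top_of_set (gen S))"
  unfolding parametrizes_def
proof (intro conjI ballI allI impI)
  let ?X = "S \<union> Collect finite"
  have mem: "(\<Sum>i<length c. of_rat (c ! i) * ternary (x i)) \<in> gen S"
    if "x \<in> tuples ?X {..<length c}" for c x
    using that unfolding gen_def tuples_def
    by (intro Q.span_sum Q.span_scale ternary_mem_gen[unfolded gen_def]) auto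
  show "(\<Union>c\<in>UNIV. (\<lambda>x. \<Sum>i<length c. of_rat (c ! i) * ternary (x i)) ` tuples ?X {..<length c}) =
      topspace (top_of_set (gen S))"
  proof (intro equalityI subsetI)
    fix z assume "z \<in> topspace (top_of_set (gen S))"
    then obtain ps where ps: "ps \<in> lists (UNIV \<times> ?X)"
      "z = (\<Sum>i<length ps. of_rat (fst (ps ! i)) * ternary (snd (ps ! i)))"
      using gen_combination[of z S] by auto
    define c where "c = map fst ps"
    define x where "x i = snd (ps ! i)" for i
    have "x \<in> tuples ?X {..<length c}"
      using ps(1) nth_mem unfolding tuples_def c_def x_def by fastforce
    moreover have "z = (\<Sum>i<length c. of_rat (c ! i) * ternary (x i))"
      unfolding ps(2) c_def x_def by (simp only: length_map) (intro sum.cong, auto)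
    ultimately show "z \<in> (\<Union>c\<in>UNIV. (\<lambda>x. \<Sum>i<length c. of_rat (c ! i) * ternary (x i)) `
        tuples ?X {..<length c})" by blast
  qed (use mem in auto)
  fix c :: "rat list" and x W
  assume x: "x \<in> tuples ?X {..<length c}"
    and "openin (top_of_set (gen S)) W \<and> (\<Sum>i<length c. of_rat (c ! i) * ternary (x i)) \<in> W"
  then obtain e where e: "e > 0" "ball (\<Sum>i<length c. of_rat (c ! i) * ternary (x i)) e \<inter> gen S \<subseteq> W"
    unfolding openin_contains_ball by blast
  \<comment> \<open>The added 1 keeps \<open>b\<close> positive when all coefficients vanish, so
    that dividing by it is possible.\<close>
  define b :: real where "b = (\<Sum>i<length c. \<bar>of_rat (c ! i)\<bar>) + 1"
  have b: "b > 0" unfolding b_def by (intro add_nonneg_pos sum_nonneg) auto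
  obtain h where h: "(1/3) ^ h < e / (b * (3/2))"
    using real_arch_pow_inv[of "e / (b * (3/2))" "1/3"] e b by auto
  have "(\<Sum>i<length c. of_rat (c ! i) * ternary (y i)) \<in> W"
    if y: "y \<in> tuples ?X {..<length c}" "agree {..<length c} h x y" for y
  proof -
    have "\<bar>(\<Sum>i<length c. of_rat (c ! i) * ternary (x i)) - (\<Sum>i<length c. of_rat (c ! i) * ternary (y i))\<bar>
        = \<bar>\<Sum>i<length c. of_rat (c ! i) * (ternary (x i) - ternary (y i))\<bar>"
      by (simp add: sum_subtractf right_diff_distrib)
    also have "\<dots> \<le> (\<Sum>i<length c. \<bar>of_rat (c ! i)\<bar> * (3/2 * (1/3) ^ h))"
    proof (rule order.trans[OF sum_abs sum_mono])
      fix i assume "i \<in> {..<length c}"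
      then have "x i \<inter> {..<h} = y i \<inter> {..<h}" using y(2) by simp
      then show "\<bar>of_rat (c ! i) * (ternary (x i) - ternary (y i))\<bar> \<le> \<bar>of_rat (c ! i)\<bar> * (3/2 * (1/3) ^ h)"
        unfolding abs_mult by (intro mult_left_mono ternary_agree) auto
    qed
    also have "\<dots> = (b - 1) * (3/2 * (1/3) ^ h)" by (simp only: b_def add_diff_cancel_right' sum_distrib_right)
    also have "\<dots> \<le> (b * (3/2)) * (1/3) ^ h" by (simp add: algebra_simps)
    also have "\<dots> < e" using h b by (simp add: pos_less_divide_eq mult.commute)
    finally show ?thesis using e(2) mem[OF y(1)] by (auto simp: dist_real_def)
  qed
  then show "\<exists>h. \<forall>y\<in>tuples ?X {..<length c}. agree {..<length c} h x y \<longrightarrow>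
      (\<Sum>i<length c. of_rat (c ! i) * ternary (y i)) \<in> W" by blast
qed auto

lemma subgroup_gen: "subgroup (gen S) real_group"
proof -
  interpret group real_group by (rule group_real_group)
  have inv: "inv\<^bsub>real_group\<^esub> x = - x" for x
    by (rule inv_equality) (auto simp: real_group_def)
  show ?thesis
    by (rule subgroupI)
      (auto simp: inv, auto simp: real_group_def gen_def intro: Q.span_neg Q.span_add Q.span_zero)
qed

section \<open>Counting \<sigma>-compact sets of reals\<close>

lemma sigma_compact_space_closed_Union:
  fixes A :: "real set"
  assumes "sigma_compact_space (top_of_set A)"
  shows "\<exists>K :: nat \<Rightarrow> real set. (\<forall>n. closed (K n)) \<and> A = (\<Union>n. K n)"
proof -
  obtain \<K> where K: "countable \<K>" "\<And>K. K \<in> \<K> \<Longrightarrow> compactin (top_of_set A) K" "\<Union>\<K> = A"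
    using assms unfolding sigma_compact_space_def by auto
  \<comment> \<open>The empty set is added to make the family nonempty, so that
    \<open>from_nat_into\<close> enumerates it.\<close>
  have "closed K" if "K \<in> insert {} \<K>" for K
    using that K(2) by (auto simp: compactin_subtopology intro: compact_imp_closed)
  moreover have r: "range (from_nat_into (insert {} \<K>)) = insert {} \<K>"
    using K(1) by (intro range_from_nat_into) auto
  ultimately have "\<forall>n. closed (from_nat_into (insert {} \<K>) n)" by blast
  moreover have "A = \<Union>(range (from_nat_into (insert {} \<K>)))" unfolding r using K(3) by auto
  ultimately show ?thesis by blast
qed

text \<open>The Cantor-Bendixson argument: the condensation points \<open>P\<close> of
  \<open>K\<close> form a nonempty perfect set, because only countably many points of
  \<open>K\<close> lie outside \<open>P\<close>.\<close>

lemma uncountable_closed_lepoll: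
  fixes K :: "real set"
  assumes "closed K" "uncountable K"
  shows "(UNIV :: real set) \<lesssim> K"
proof -
  define P where "P = {x. \<forall>T. open T \<and> x \<in> T \<longrightarrow> uncountable (K \<inter> T)}"
  obtain B :: "real set set" where B: "countable B" "topological_basis B"
    using ex_countable_basis by blast
  define B' where "B' = {b \<in> B. countable (K \<inter> b)}"
  have "K - P \<subseteq> (\<Union>b\<in>B'. K \<inter> b)"
  proof
    fix x assume "x \<in> K - P"
    then obtain T where T: "x \<in> K" "open T" "x \<in> T" "countable (K \<inter> T)" unfolding P_def by blast
    then obtain b where b: "b \<in> B" "x \<in> b" "b \<subseteq> T" using topological_basisE[OF B(2)] by metis
    then have "K \<inter> b \<subseteq> K \<inter> T" by blast
    then have "countable (K \<inter> b)" using T(4) countable_subset by metis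
    then show "x \<in> (\<Union>b\<in>B'. K \<inter> b)" using T(1) b unfolding B'_def by blast
  qed
  moreover have "countable (\<Union>b\<in>B'. K \<inter> b)"
  proof (rule countable_UN)
    show "countable B'" using B(1) unfolding B'_def by (rule countable_subset[rotated]) blast
  qed (simp add: B'_def)
  ultimately have KP: "countable (K - P)" using countable_subset by blast
  have PK: "P \<subseteq> K"
  proof
    fix x assume "x \<in> P"
    then have "open (- K) \<and> x \<in> - K \<longrightarrow> uncountable (K \<inter> - K)" unfolding P_def by blast
    then show "x \<in> K" using assms(1) by auto
  qed
  have unc: "uncountable (P \<inter> T)" if "uncountable (K \<inter> T)" for T
  proof
    assume "countable (P \<inter> T)"
    then have "countable (P \<inter> T \<union> (K - P))" using KP by simp
    moreover have "K \<inter> T \<subseteq> P \<inter> T \<union> (K - P)" by blast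
    ultimately show False using that countable_subset by blast
  qed
  have "euclidean derived_set_of P = P"
  proof (intro equalityI subsetI)
    fix x assume x: "x \<in> euclidean derived_set_of P"
    have "uncountable (K \<inter> T)" if T: "open T" "x \<in> T" for T
    proof -
      obtain y where "y \<in> P" "y \<in> T" using x T unfolding in_derived_set_of by auto
      then show ?thesis using T(1) unfolding P_def by blast
    qed
    then show "x \<in> P" unfolding P_def by blast
  next
    fix x assume x: "x \<in> P"
    have "\<exists>y. y \<noteq> x \<and> y \<in> P \<and> y \<in> T" if T: "open T" "x \<in> T" for T
    proof (rule ccontr)
      assume "\<not> ?thesis"
      then have "P \<inter> T \<subseteq> {x}" by blast
      then have "countable (P \<inter> T)" by (rule countable_subset) simp
      moreover have "uncountable (K \<inter> T)" using x T unfolding P_def by simp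
      ultimately show False using unc by simp
    qed
    then show "x \<in> euclidean derived_set_of P" unfolding in_derived_set_of by auto
  qed
  moreover have "P \<noteq> {}" using unc[of UNIV] assms(2) by auto
  ultimately have "(UNIV :: real set) \<lesssim> P"
    by (intro lepoll_perfect_set) (auto simp: completely_metrizable_space_euclidean)
  then show ?thesis using PK by (meson lepoll_trans1 lepoll_trans subset_imp_lepoll)
qed

lemma sigma_compact_uncountable_card:
  fixes A :: "real set"
  assumes "sigma_compact_space (top_of_set A)" "uncountable A"
  shows "|UNIV :: real set| \<le>o |A|"
proof -
  obtain K :: "nat \<Rightarrow> real set" where K: "\<And>n. closed (K n)" "A = (\<Union>n. K n)"
    using sigma_compact_space_closed_Union[OF assms(1)] by auto
  then obtain n where "uncountable (K n)" using assms(2) by auto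
  then have "(UNIV :: real set) \<lesssim> K n" using K(1) by (intro uncountable_closed_lepoll)
  then obtain f :: "real \<Rightarrow> real" where "inj f" "range f \<subseteq> K n" unfolding lepoll_def by auto
  then show ?thesis using K(2) card_of_ordLeq[of UNIV A] by blast
qed

text \<open>A countable union of closed sets is determined by the pairs of an index \<open>n\<close>
  and a basic open set missing the \<open>n\<close>-th closed set. These pairs form a subset of a
  countable set, and \<open>ternary\<close> turns sets of naturals into reals injectively.\<close>

lemma card_of_sigma_compact:
  "|{A :: real set. sigma_compact_space (top_of_set A)}| \<le>o |UNIV :: real set|"
proof -
  obtain B :: "real set set" where B: "countable B" "topological_basis B"
    using ex_countable_basis by blast
  have "\<forall>A. \<exists>K :: nat \<Rightarrow> real set. sigma_compact_space (top_of_set A) \<longrightarrow>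
      (\<forall>n. closed (K n)) \<and> A = (\<Union>n. K n)"
    using sigma_compact_space_closed_Union by blast
  then obtain K :: "real set \<Rightarrow> nat \<Rightarrow> real set" where K: "\<And>A. sigma_compact_space (top_of_set A) \<Longrightarrow>
      (\<forall>n. closed (K A n)) \<and> A = (\<Union>n. K A n)" by metis
  define code where "code A = {(n, b). b \<in> B \<and> b \<inter> K A n = {}}" for A
  have dec: "A = (\<Union>n. - \<Union>{b. (n, b) \<in> code A})" if A: "sigma_compact_space (top_of_set A)" for A
  proof -
    have "\<Union>{b. (n, b) \<in> code A} = - K A n" for n
    proof (intro equalityI subsetI)
      fix x assume "x \<in> - K A n"
      moreover have "open (- K A n)" using K[OF A] by auto
      ultimately obtain b where "b \<in> B" "x \<in> b" "b \<subseteq> - K A n" using topological_basisE[OF B(2)] by metis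
      then show "x \<in> \<Union>{b. (n, b) \<in> code A}" unfolding code_def by blast
    qed (auto simp: code_def)
    then show ?thesis using K[OF A] by auto
  qed
  have "countable ((UNIV :: nat set) \<times> B)" using B(1) by auto
  then obtain f :: "nat \<times> real set \<Rightarrow> nat" where f: "inj_on f (UNIV \<times> B)" by (rule countableE)
  have sub: "code A \<subseteq> UNIV \<times> B" for A unfolding code_def by auto
  have "inj_on (\<lambda>A. ternary (f ` code A)) {A. sigma_compact_space (top_of_set A)}"
  proof (rule inj_onI)
    fix A A' assume A: "A \<in> {A. sigma_compact_space (top_of_set A)}"
      "A' \<in> {A. sigma_compact_space (top_of_set A)}" and "ternary (f ` code A) = ternary (f ` code A')"
    then have "f ` code A = f ` code A'" using inj_ternary by (simp add: inj_eq)
    then have "code A = code A'" using inj_on_image_eq_iff[OF f sub sub] by blast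
    then show "A = A'" using dec[of A] dec[of A'] A by simp
  qed
  then show ?thesis using card_of_ordLeq by (metis subset_UNIV)
qed

text \<open>Extend \<open>{1}\<close> to a rational basis of the span inside the set of generators,
  and keep the sets coded in that basis. The span is unchanged, so the cardinality is too.\<close>

lemma exists_independent:
  assumes M: "|M| =o dominating_number"
  shows "\<exists>M'\<subseteq>M. |M'| =o dominating_number \<and> infinite M' \<and>
    (\<forall>S x. S \<subseteq> M' \<longrightarrow> x \<in> M' - S \<longrightarrow> ternary x \<notin> gen S)"
proof -
  have "uncountable M"
  proof
    assume "countable M"
    then have "|M| <o dominating_number" using countable_imp_small small_def by metis
    then show False using M not_ordLess_ordIso by blast
  qed
  obtain B where B: "{1} \<subseteq> B" "B \<subseteq> insert 1 (ternary ` M)" "Q.independent B"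
    "insert 1 (ternary ` M) \<subseteq> Q.span B"
    by (rule Q.maximal_independent_subset_extend[of "{1}" "insert 1 (ternary ` M)"]) auto
  define M' where "M' = {x \<in> M. ternary x \<in> B \<and> ternary x \<noteq> 1}"
  have B_eq: "B = insert 1 (ternary ` M')" using B(1,2) unfolding M'_def by auto
  have "M' \<subseteq> M" unfolding M'_def by blast
  have sub: "ternary ` M \<subseteq> gen M'" using B(4) unfolding gen_def B_eq by simp
  have inj: "inj_on ternary M" using inj_ternary inj_on_subset by blast
  \<comment> \<open>\<open>card_of_gen\<close> requires this. A finite \<open>M'\<close> would have
    a countable span, which contains the codes of the uncountable \<open>M\<close>.\<close>
  have "infinite M'"
  proof
    assume "finite M'"
    then have "countable (UNIV \<times> (M' \<union> Collect finite) :: (rat \<times> nat set) set)"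
      by (intro countable_SIGMA countable_Un countable_Collect_finite) (auto simp: countable_finite)
    then have "countable ((\<lambda>ps. \<Sum>i<length ps. of_rat (fst (ps ! i)) * ternary (snd (ps ! i))) `
        lists (UNIV \<times> (M' \<union> Collect finite)))" by (intro countable_image countable_lists)
    moreover have "ternary ` M \<subseteq> (\<lambda>ps. \<Sum>i<length ps. of_rat (fst (ps ! i)) * ternary (snd (ps ! i))) `
        lists (UNIV \<times> (M' \<union> Collect finite))" using gen_combination sub by blast
    ultimately have "countable (ternary ` M)" by (rule countable_subset[rotated])
    then have "countable M" using inj by (rule countable_image_inj_on)
    then show False using \<open>uncountable M\<close> by simp
  qed
  have "|M| \<le>o |gen M'|" using inj sub card_of_ordLeq by metis
  then have "|M| \<le>o |M'|" using card_of_gen[OF \<open>infinite M'\<close>] by (rule ordLeq_ordIso_trans)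
  then have "|M'| =o |M|" using card_of_mono1[OF \<open>M' \<subseteq> M\<close>] by (simp add: ordIso_iff_ordLeq)
  then have "|M'| =o dominating_number" using M by (rule ordIso_transitive)
  moreover have "ternary x \<notin> gen S" if "S \<subseteq> M'" "x \<in> M' - S" for S x
  proof
    assume x: "ternary x \<in> gen S"
    have "ternary x \<noteq> 1" using that unfolding M'_def by blast
    moreover have "ternary x \<notin> ternary ` S" using that inj_image_mem_iff[OF inj_ternary] by blast
    moreover have "insert 1 (ternary ` S) \<subseteq> B" using that(1) B(1) unfolding M'_def by blast
    ultimately have "insert 1 (ternary ` S) \<subseteq> B - {ternary x}" by blast
    from subsetD[OF Q.span_mono[OF this]] have "ternary x \<in> Q.span (B - {ternary x})"
      using x unfolding gen_def .
    moreover have "ternary x \<in> B" using that unfolding M'_def by blast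
    ultimately have "Q.dependent B" unfolding Q.dependent_def by (rule bexI)
    then show False using B(3) by simp
  qed
  ultimately show ?thesis using \<open>M' \<subseteq> M\<close> \<open>infinite M'\<close> by (intro exI[of _ M']) simp
qed

text \<open>Split an independent family into halves \<open>L\<close> and \<open>R\<close> of size d.
  By independence the groups generated by \<open>S \<union> R\<close> with
  \<open>S \<subseteq> L\<close> are pairwise different, and keeping \<open>R\<close> gives each of
  them cardinality d. If all were \<sigma>-compact, the power set of \<open>L\<close> would have at
  most continuum many elements, and the continuum would be at most d.\<close>

lemma exists_not_sigma_compact:
  assumes M: "|M| =o dominating_number"
  shows "\<exists>S\<subseteq>M. infinite S \<and> |S| =o dominating_number \<and> \<not> sigma_compact_space (top_of_set (gen S))"
proof -
  obtain M' where M': "M' \<subseteq> M" "|M'| =o dominating_number" "infinite M'"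
    "\<And>S x. S \<subseteq> M' \<Longrightarrow> x \<in> M' - S \<Longrightarrow> ternary x \<notin> gen S"
    using exists_independent[OF M] by (elim exE conjE) blast
  have "|M' <+> M'| =o |M'|"
    using card_of_Plus_infinite[OF M'(3) ordIso_imp_ordLeq[OF card_of_refl]] by blast
  then obtain f where f: "bij_betw f (M' <+> M') M'" using card_of_ordIso by metis
  define L R where "L = f ` Inl ` M'" and "R = f ` Inr ` M'"
  have inj: "inj_on f (M' <+> M')" using f by (simp add: bij_betw_def)
  have "L \<union> R = f ` (M' <+> M')" unfolding L_def R_def Plus_def image_Un ..
  moreover have "L \<inter> R = f ` (Inl ` M' \<inter> Inr ` M')"
    unfolding L_def R_def by (rule inj_on_image_Int[OF inj, symmetric]) auto
  moreover have "Inl ` M' \<inter> Inr ` M' = {}" by auto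
  ultimately have LR: "L \<union> R = M'" "L \<inter> R = {}"
    using f by (simp_all add: bij_betw_def)
  from inj have "inj_on (\<lambda>x. f (Inl x)) M'" "inj_on (\<lambda>x. f (Inr x)) M'"
    unfolding inj_on_def by auto
  then have "|M'| \<le>o |L|" "|M'| \<le>o |R|"
    unfolding L_def R_def image_image by (metis card_of_ordLeq order_refl)+
  then have R: "|M'| \<le>o |S|" if "R \<subseteq> S" for S using card_of_mono1[OF that] ordLeq_transitive by blast
  have S: "infinite S \<and> |S| =o dominating_number" if "R \<subseteq> S" "S \<subseteq> M'" for S
  proof -
    have "|S| =o |M'|" using R[OF that(1)] card_of_mono1[OF that(2)] by (simp add: ordIso_iff_ordLeq)
    then show ?thesis using M'(2,3) ordIso_transitive card_of_ordIso_finite by blast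
  qed
  have "\<exists>S\<subseteq>L. \<not> sigma_compact_space (top_of_set (gen (S \<union> R)))"
  proof (rule ccontr)
    assume "\<not> ?thesis"
    then have sc: "\<And>S. S \<subseteq> L \<Longrightarrow> sigma_compact_space (top_of_set (gen (S \<union> R)))" by blast
    have sep: "\<not> x \<in> S'" if "S \<subseteq> L" "S' \<subseteq> L" "gen (S \<union> R) = gen (S' \<union> R)" "x \<notin> S" for S S' x
    proof
      assume x: "x \<in> S'"
      have "x \<in> M' - (S \<union> R)" using LR that x by blast
      moreover have "S \<union> R \<subseteq> M'" using LR that by blast
      ultimately have "ternary x \<notin> gen (S' \<union> R)" using M'(4) that(3) by metis
      then show False using ternary_mem_gen[of x "S' \<union> R"] x by blast
    qed
    have "inj_on (\<lambda>S. gen (S \<union> R)) (Pow L)"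
    proof (rule inj_onI)
      fix S S' assume "S \<in> Pow L" "S' \<in> Pow L" "gen (S \<union> R) = gen (S' \<union> R)"
      then show "S = S'" using sep by (metis PowD subset_antisym subsetI)
    qed
    moreover have "(\<lambda>S. gen (S \<union> R)) ` Pow L \<subseteq> {A. sigma_compact_space (top_of_set A)}" using sc by auto
    ultimately have "|Pow L| \<le>o |{A :: real set. sigma_compact_space (top_of_set A)}|"
      using card_of_ordLeq by metis
    also note card_of_sigma_compact
    \<comment> \<open>The case of the empty \<open>S\<close>: the uncountable group
      \<open>gen R\<close> would be \<sigma>-compact, hence at least of size continuum.\<close>
    also have "|UNIV :: real set| \<le>o |gen R|"
    proof (rule sigma_compact_uncountable_card)
      show "sigma_compact_space (top_of_set (gen R))" using sc[of "{}"] by simp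
      show "uncountable (gen R)"
      proof
        assume "countable (gen R)"
        then have "small (gen R)" by (rule countable_imp_small)
        moreover have "|gen R| =o dominating_number"
          using S[of R] card_of_gen[of R] LR ordIso_transitive by blast
        ultimately show False unfolding small_def using not_ordLess_ordIso by blast
      qed
    qed
    also have "|gen R| \<le>o |R|" using S[of R] LR card_of_gen[of R] ordIso_imp_ordLeq by blast
    also have "|R| \<le>o |M'|" using LR by (intro card_of_mono1) blast
    also have "|M'| \<le>o |L|" by fact
    finally have "|Pow L| \<le>o |L|" .
    then show False using card_of_Pow[of L] not_ordLess_ordLeq by blast
  qed
  then obtain S where "S \<subseteq> L" "\<not> sigma_compact_space (top_of_set (gen (S \<union> R)))" by blast
  moreover have "R \<subseteq> S \<union> R" "S \<union> R \<subseteq> M'" using LR \<open>S \<subseteq> L\<close> by auto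
  ultimately show ?thesis using S M'(1) by (meson subset_trans)
qed

theorem theorem5:
  assumes Ax
  shows "\<exists>G :: real set.
    subgroup G real_group \<and>
    \<not> sigma_compact_space (top_of_set G) \<and>
    |G| =o dominating_number \<and>
    S_fin (Omega_covers (top_of_set G)) (Omega_covers (top_of_set G)) \<and>
    translate_selection (real_group\<lparr>carrier := G\<rparr>) (top_of_set G) \<and>
    (\<forall>k::nat. k \<ge> 1 \<longrightarrow>
       translate_selection (product_group {1..k} (\<lambda>_. real_group\<lparr>carrier := G\<rparr>))
         (product_topology (\<lambda>_. top_of_set G) {1..k}))"
proof -
  obtain I M where "small_ideal I M" "|M| =o dominating_number"
    using exists_small_ideal[OF assms] by blast
  moreover then obtain S where S: "S \<subseteq> M" "infinite S" "|S| =o dominating_number"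
    "\<not> sigma_compact_space (top_of_set (gen S))"
    using exists_not_sigma_compact by blast
  \<comment> \<open>From here on \<open>pts\<close> is built from the subfamily \<open>S\<close>,
    matching the parametrization of \<open>gen S\<close>.\<close>
  ultimately interpret small_ideal I S using small_ideal_subset by blast
  define G where "G = real_group\<lparr>carrier := gen S\<rparr>"
  define T where "T = top_of_set (gen S)"
  have par: "parametrizes pts UNIV (\<lambda>c. {..<length c})
      (\<lambda>c x. \<Sum>i<length c. of_rat (c ! i) * ternary (x i)) T"
    unfolding pts_def T_def by (rule parametrizes_gen)
  have guess_T: "guessable T" using par by (rule parametrizes_imp_guessable)
  have guess_power: "guessable (product_topology (\<lambda>_. T) {1..k})" for k :: nat
    using parametrizes_power[OF par, of "{1..k}"] by (intro parametrizes_imp_guessable) simp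
  interpret real: group real_group by (rule group_real_group)
  have group_G: "group G" unfolding G_def by (intro real.subgroup_imp_group subgroup_gen)
  have top_G: "carrier G = topspace T" by (simp add: G_def T_def)
  have cont: "continuous_map T T (\<lambda>z. g \<otimes>\<^bsub>G\<^esub> z)" if "g \<in> carrier G" for g
  proof -
    have "(+) g ` gen S \<subseteq> gen S"
      using that by (auto simp: G_def gen_def intro: Q.span_add)
    then show ?thesis
      unfolding T_def G_def continuous_map_in_subtopology
      by (auto simp: real_group_def intro!: continuous_intros)
  qed
  have "translate_selection G T"
    by (intro translate_selection_guessable group_G top_G guess_T cont)
  moreover have "translate_selection (product_group {1..k} (\<lambda>_. G)) (product_topology (\<lambda>_. T) {1..k})"
    for k :: nat
  proof (rule translate_selection_guessable)
    show "group (product_group {1..k} (\<lambda>_. G))" using group_G by simp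
    show "carrier (product_group {1..k} (\<lambda>_. G)) = topspace (product_topology (\<lambda>_. T) {1..k})"
      using top_G by simp
    show "continuous_map (product_topology (\<lambda>_. T) {1..k}) (product_topology (\<lambda>_. T) {1..k})
        (\<lambda>z. g \<otimes>\<^bsub>product_group {1..k} (\<lambda>_. G)\<^esub> z)" if "g \<in> carrier (product_group {1..k} (\<lambda>_. G))" for g
      using that by (intro continuous_map_product_translation cont) auto
  qed (rule guess_power)
  moreover have "S_fin (Omega_covers T) (Omega_covers T)"
    by (rule S_fin_Omega_covers) (rule guess_power)
  moreover have "|gen S| =o dominating_number"
    using card_of_gen[OF S(2)] S(3) ordIso_transitive by blast
  ultimately show ?thesis
    using subgroup_gen[of S] S(4) unfolding G_def T_def by blast
qed

end
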